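(* Let $M$ and $N$ be Hilbert $C^*$-bimodules over a $C^*$-algebra $A$. If $\Phi:M\to N$ is an isomorphism of left Hilbert $C^*$-modules over $A$, then there is a partial automorphism $(I,J,\theta)$ of $A$ such that $\Phi:M_\theta\to N$ is an isomorphism of Hilbert $C^*$-bimodules over $A$. Namely, $I=\langle N,N\rangle_R$, $J=\langle M,M\rangle_R$, and $\theta(\langle\Phi(m_0),\Phi(m_1)\rangle_R)=\langle m_0,m_1\rangle_R$ for all $m_0,m_1\in M$.
   Context: A Hilbert $C^*$-bimodule over a $C^*$-algebra $A$ is an $A$-$A$-bimodule $M$ that is both a left and a right Hilbert $C^*$-module over $A$ (with $A$-valued inner products $\langle\cdot,\cdot\rangle_L$, linear in the first variable, and $\langle\cdot,\cdot\rangle_R$, linear in the second variable; neither is assumed full) and satisfies $\langle m,n\rangle_L\,p=m\,\langle n,p\rangle_R$ for all $m,n,p\in M$. $\langle M,M\rangle_L$ and $\langle M,M\rangle_R$ denote the closed linear spans of the inner products, which are closed two-sided ideals of $A$. An isomorphism of left (resp. right) Hilbert $C^*$-modules is an isomorphism of left (resp. right) $A$-modules preserving the left (resp. right) inner product; an isomorphism of Hilbert $C^*$-bimodules is an isomorphism of both left and right Hilbert $C^*$-modules. A partial automorphism $(I,J,\theta)$ of $A$ consists of closed two-sided ideals $I,J$ of $A$ and a $*$-isomorphism $\theta:I\to J$. For such a partial automorphism and a Hilbert $C^*$-bimodule $M$ over $A$, $M_\theta$ is the Hilbert $C^*$-bimodule with underlying vector space $MJ$, actions $a\cdot(mj)=amj$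 and $(mj)\cdot a=m\,\theta[\theta^{-1}(j)a]$ for $m\in M$, $j\in J$, $a\in A$, and inner products $\langle x,y\rangle_L^{M_\theta}=\langle x,y\rangle_L^M$, $\langle x,y\rangle_R^{M_\theta}=\theta^{-1}(\langle x,y\rangle_R^M)$ for $x,y\in MJ$. (When $J=\langle M,M\rangle_R$ one has $MJ=M$ as vector spaces.) *)

theory Defs
  imports "HOL-Analysis.Analysis"
begin

class complex_vector = real_vector +
  fixes scaleC :: "complex \<Rightarrow> 'a \<Rightarrow> 'a"  (infixr "*\<^sub>C" 75)
  assumes scaleC_add_right: "c *\<^sub>C (x + y) = c *\<^sub>C x + c *\<^sub>C y"
    and scaleC_add_left: "(c + d) *\<^sub>C x = c *\<^sub>C x + d *\<^sub>C x"
    and scaleC_scaleC: "c *\<^sub>C d *\<^sub>C x = (c * d) *\<^sub>C x"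
    and scaleC_one: "1 *\<^sub>C x = x"
    and scaleR_scaleC: "r *\<^sub>R x = complex_of_real r *\<^sub>C x"

global_interpretation complex_vector: vector_space "scaleC :: complex \<Rightarrow> 'a \<Rightarrow> 'a::complex_vector"
  defines csubspace = complex_vector.subspace
    and cspan = complex_vector.span
  by unfold_locales (simp_all add: scaleC_add_right scaleC_add_left scaleC_scaleC scaleC_one)

text \<open>Not necessarily unital; submultiplicativity of the norm comes from
  \<^class>\<open>real_normed_algebra\<close>.\<close>

class cstar_algebra = complex_vector + real_normed_algebra + banach +
  fixes star :: "'a \<Rightarrow> 'a"
  assumes norm_scaleC: "norm (c *\<^sub>C x) = cmod c * norm x"
    and mult_scaleC_left: "(c *\<^sub>C x) * y = c *\<^sub>C (x * y)"
    and mult_scaleC_right: "x * (c *\<^sub>C y) = c *\<^sub>C (x * y)"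
    and star_star: "star (star x) = x"
    and star_add: "star (x + y) = star x + star y"
    and star_scaleC: "star (c *\<^sub>C x) = cnj c *\<^sub>C star x"
    and star_mult: "star (x * y) = star y * star x"
    and cstar_identity: "norm (star x * x) = (norm x)\<^sup>2"

definition positive :: "'a::cstar_algebra \<Rightarrow> bool"
  where "positive a \<longleftrightarrow> (\<exists>b. a = star b * b)"

definition closed_ideal :: "'a::cstar_algebra set \<Rightarrow> bool"
  where "closed_ideal I \<longleftrightarrow>
    csubspace I \<and> closed I \<and> (\<forall>a. \<forall>x\<in>I. a * x \<in> I \<and> x * a \<in> I)"

locale partial_automorphism =
  fixes I J :: "'a::cstar_algebra set" and \<theta> :: "'a \<Rightarrow> 'a"
  assumes ideal_dom: "closed_ideal I"
    and ideal_range: "closed_ideal J"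
    and bij: "bij_betw \<theta> I J"
    and add: "x \<in> I \<Longrightarrow> y \<in> I \<Longrightarrow> \<theta> (x + y) = \<theta> x + \<theta> y"
    and scale: "x \<in> I \<Longrightarrow> \<theta> (c *\<^sub>C x) = c *\<^sub>C \<theta> x"
    and mult: "x \<in> I \<Longrightarrow> y \<in> I \<Longrightarrow> \<theta> (x * y) = \<theta> x * \<theta> y"
    and star: "x \<in> I \<Longrightarrow> \<theta> (star x) = star (\<theta> x)"

text \<open>The vector space operations are those of the type \<^typ>\<open>'m\<close>; the module itself is the
  subset \<open>mcarrier\<close>, so that \<open>MJ\<close> can be formed inside the type of \<open>M\<close>. The values of
  the operations outside \<open>mcarrier\<close> are irrelevant.\<close>

record ('a, 'm) bimodule =
  mcarrier :: "'m set"
  lact :: "'a \<Rightarrow> 'm \<Rightarrow> 'm"  (infixr "\<rhd>\<index>" 70)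
  ract :: "'m \<Rightarrow> 'a \<Rightarrow> 'm"  (infixl "\<lhd>\<index>" 70)
  linner :: "'m \<Rightarrow> 'm \<Rightarrow> 'a"
  rinner :: "'m \<Rightarrow> 'm \<Rightarrow> 'a"

definition ip_norm :: "('m \<Rightarrow> 'm \<Rightarrow> 'a::cstar_algebra) \<Rightarrow> 'm \<Rightarrow> real"
  where "ip_norm ip x = sqrt (norm (ip x x))"

definition ip_complete :: "('m::complex_vector \<Rightarrow> 'm \<Rightarrow> 'a::cstar_algebra) \<Rightarrow> 'm set \<Rightarrow> bool"
  where "ip_complete ip S \<longleftrightarrow>
    (\<forall>X::nat \<Rightarrow> 'm. (\<forall>n. X n \<in> S) \<longrightarrow>
      (\<forall>e>0. \<exists>K. \<forall>i\<ge>K. \<forall>j\<ge>K. ip_norm ip (X i - X j) < e) \<longrightarrow>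
      (\<exists>x\<in>S. (\<lambda>n. ip_norm ip (X n - x)) \<longlonglongrightarrow> 0))"

locale left_hilbert_module =
  fixes M :: "('a::cstar_algebra, 'm::complex_vector) bimodule"  (structure)
  assumes lsubspace: "csubspace (mcarrier M)"
    and lact_closed: "x \<in> mcarrier M \<Longrightarrow> a \<rhd> x \<in> mcarrier M"
    and lact_add: "x \<in> mcarrier M \<Longrightarrow> y \<in> mcarrier M \<Longrightarrow> a \<rhd> (x + y) = a \<rhd> x + a \<rhd> y"
    and add_lact: "x \<in> mcarrier M \<Longrightarrow> (a + b) \<rhd> x = a \<rhd> x + b \<rhd> x"
    and mult_lact: "x \<in> mcarrier M \<Longrightarrow> (a * b) \<rhd> x = a \<rhd> (b \<rhd> x)"
    and lact_scaleC: "x \<in> mcarrier M \<Longrightarrow> a \<rhd> (c *\<^sub>C x) = c *\<^sub>C (a \<rhd> x)"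
    and scaleC_lact: "x \<in> mcarrier M \<Longrightarrow> (c *\<^sub>C a) \<rhd> x = c *\<^sub>C (a \<rhd> x)"
    and linner_add: "x \<in> mcarrier M \<Longrightarrow> y \<in> mcarrier M \<Longrightarrow> z \<in> mcarrier M \<Longrightarrow>
      linner M (x + y) z = linner M x z + linner M y z"
    and linner_scaleC: "x \<in> mcarrier M \<Longrightarrow> y \<in> mcarrier M \<Longrightarrow>
      linner M (c *\<^sub>C x) y = c *\<^sub>C linner M x y"
    and linner_lact: "x \<in> mcarrier M \<Longrightarrow> y \<in> mcarrier M \<Longrightarrow>
      linner M (a \<rhd> x) y = a * linner M x y"
    and star_linner: "x \<in> mcarrier M \<Longrightarrow> y \<in> mcarrier M \<Longrightarrow>
      star (linner M x y) = linner M y x"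
    and linner_positive: "x \<in> mcarrier M \<Longrightarrow> positive (linner M x x)"
    and linner_definite: "x \<in> mcarrier M \<Longrightarrow> linner M x x = 0 \<Longrightarrow> x = 0"
    and linner_complete: "ip_complete (linner M) (mcarrier M)"

locale right_hilbert_module =
  fixes M :: "('a::cstar_algebra, 'm::complex_vector) bimodule"  (structure)
  assumes rsubspace: "csubspace (mcarrier M)"
    and ract_closed: "x \<in> mcarrier M \<Longrightarrow> x \<lhd> a \<in> mcarrier M"
    and ract_add: "x \<in> mcarrier M \<Longrightarrow> y \<in> mcarrier M \<Longrightarrow> (x + y) \<lhd> a = x \<lhd> a + y \<lhd> a"
    and add_ract: "x \<in> mcarrier M \<Longrightarrow> x \<lhd> (a + b) = x \<lhd> a + x \<lhd> b"
    and mult_ract: "x \<in> mcarrier M \<Longrightarrow> x \<lhd> (a * b) = x \<lhd> a \<lhd> b"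
    and ract_scaleC: "x \<in> mcarrier M \<Longrightarrow> (c *\<^sub>C x) \<lhd> a = c *\<^sub>C (x \<lhd> a)"
    and scaleC_ract: "x \<in> mcarrier M \<Longrightarrow> x \<lhd> (c *\<^sub>C a) = c *\<^sub>C (x \<lhd> a)"
    and rinner_add: "x \<in> mcarrier M \<Longrightarrow> y \<in> mcarrier M \<Longrightarrow> z \<in> mcarrier M \<Longrightarrow>
      rinner M x (y + z) = rinner M x y + rinner M x z"
    and rinner_scaleC: "x \<in> mcarrier M \<Longrightarrow> y \<in> mcarrier M \<Longrightarrow>
      rinner M x (c *\<^sub>C y) = c *\<^sub>C rinner M x y"
    and rinner_ract: "x \<in> mcarrier M \<Longrightarrow> y \<in> mcarrier M \<Longrightarrow>
      rinner M x (y \<lhd> a) = rinner M x y * a"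
    and star_rinner: "x \<in> mcarrier M \<Longrightarrow> y \<in> mcarrier M \<Longrightarrow>
      star (rinner M x y) = rinner M y x"
    and rinner_positive: "x \<in> mcarrier M \<Longrightarrow> positive (rinner M x x)"
    and rinner_definite: "x \<in> mcarrier M \<Longrightarrow> rinner M x x = 0 \<Longrightarrow> x = 0"
    and rinner_complete: "ip_complete (rinner M) (mcarrier M)"

locale hilbert_bimodule = left_hilbert_module M + right_hilbert_module M
  for M :: "('a::cstar_algebra, 'm::complex_vector) bimodule"  (structure) +
  assumes act_assoc: "x \<in> mcarrier M \<Longrightarrow> (a \<rhd> x) \<lhd> b = a \<rhd> (x \<lhd> b)"
    and inner_compat: "x \<in> mcarrier M \<Longrightarrow> y \<in> mcarrier M \<Longrightarrow> z \<in> mcarrier M \<Longrightarrow>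
      linner M x y \<rhd> z = x \<lhd> rinner M y z"

definition right_ideal_of ::
    "('a::cstar_algebra, 'm::complex_vector) bimodule \<Rightarrow> 'a set"  ("\<langle>_\<rangle>\<^sub>R")
  where "\<langle>M\<rangle>\<^sub>R = closure (cspan {rinner M x y | x y. x \<in> mcarrier M \<and> y \<in> mcarrier M})"

locale carrier_iso =
  fixes M :: "('a::cstar_algebra, 'm::complex_vector) bimodule"
    and N :: "('a, 'n::complex_vector) bimodule"
    and \<Phi> :: "'m \<Rightarrow> 'n"
  assumes bij: "bij_betw \<Phi> (mcarrier M) (mcarrier N)"
    and add: "x \<in> mcarrier M \<Longrightarrow> y \<in> mcarrier M \<Longrightarrow> \<Phi> (x + y) = \<Phi> x + \<Phi> y"
    and scaleC: "x \<in> mcarrier M \<Longrightarrow> \<Phi> (c *\<^sub>C x) = c *\<^sub>C \<Phi> x"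

locale left_hilbert_iso =
  carrier_iso M N \<Phi> + left_M: left_hilbert_module M + left_N: left_hilbert_module N
  for M :: "('a::cstar_algebra, 'm::complex_vector) bimodule"
    and N :: "('a, 'n::complex_vector) bimodule" and \<Phi> +
  assumes lact: "x \<in> mcarrier M \<Longrightarrow> \<Phi> (a \<rhd>\<^bsub>M\<^esub> x) = a \<rhd>\<^bsub>N\<^esub> \<Phi> x"
    and linner: "x \<in> mcarrier M \<Longrightarrow> y \<in> mcarrier M \<Longrightarrow>
      linner N (\<Phi> x) (\<Phi> y) = linner M x y"

locale right_hilbert_iso =
  carrier_iso M N \<Phi> + right_M: right_hilbert_module M + right_N: right_hilbert_module N
  for M :: "('a::cstar_algebra, 'm::complex_vector) bimodule"
    and N :: "('a, 'n::complex_vector) bimodule" and \<Phi> +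
  assumes ract: "x \<in> mcarrier M \<Longrightarrow> \<Phi> (x \<lhd>\<^bsub>M\<^esub> a) = \<Phi> x \<lhd>\<^bsub>N\<^esub> a"
    and rinner: "x \<in> mcarrier M \<Longrightarrow> y \<in> mcarrier M \<Longrightarrow>
      rinner N (\<Phi> x) (\<Phi> y) = rinner M x y"

locale hilbert_bimodule_iso =
  left_hilbert_iso M N \<Phi> + right_hilbert_iso M N \<Phi> +
  bimodule_M: hilbert_bimodule M + bimodule_N: hilbert_bimodule N
  for M :: "('a::cstar_algebra, 'm::complex_vector) bimodule"
    and N :: "('a, 'n::complex_vector) bimodule" and \<Phi>

text \<open>\<open>M\<^sub>\<theta>\<close>. By Cohen factorization the set of products \<open>m \<lhd> j\<close> already is the closed
  submodule \<open>MJ\<close>. The right action is given through a factorization of \<open>x\<close>, on whose choice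
  the result does not depend.\<close>

definition twist :: "('a::cstar_algebra, 'm::complex_vector) bimodule \<Rightarrow>
    'a set \<Rightarrow> 'a set \<Rightarrow> ('a \<Rightarrow> 'a) \<Rightarrow> ('a, 'm) bimodule"
  where "twist M I J \<theta> =
    \<lparr>mcarrier = {m \<lhd>\<^bsub>M\<^esub> j | m j. m \<in> mcarrier M \<and> j \<in> J},
     lact = lact M,
     ract = (\<lambda>x a. THE y. \<exists>m\<in>mcarrier M. \<exists>j\<in>J.
       x = m \<lhd>\<^bsub>M\<^esub> j \<and> y = m \<lhd>\<^bsub>M\<^esub> \<theta> (inv_into I \<theta> j * a)),
     linner = linner M,
     rinner = (\<lambda>x y. inv_into I \<theta> (rinner M x y))\<rparr>"

end

theory Submission
  imports Defs
begin

text \<open>Call \<open>b\<close> and \<open>c\<close> intertwined if \<open>\<Phi>(m b) = \<Phi>(m) c\<close> for all \<open>m\<close>. Since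
  \<open>m \<langle>x, y\<rangle>\<^sub>R = \<langle>m, x\<rangle>\<^sub>L y\<close>, the elements \<open>\<langle>x, y\<rangle>\<^sub>R\<close> and \<open>\<langle>\<Phi> x, \<Phi> y\<rangle>\<^sub>R\<close> are intertwined, and
  \<open>\<theta>\<close> sends \<open>c\<close> to the unique intertwined \<open>b\<close>. Intertwined elements have the same norm: otherwise
  one reduces to self-adjoint \<open>b\<close>, \<open>c\<close> with \<open>\<parallel>c\<parallel> < \<parallel>b\<parallel>\<close>; then \<open>\<parallel>b\<parallel>\<^sup>2 - c\<^sup>2\<close> is invertible by a
  Neumann series, so \<open>\<parallel>b\<parallel>\<^sup>2 - b\<^sup>2\<close> maps \<open>M\<close> onto \<open>M\<close> and divides every inner product of \<open>M\<close>, in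
  particular \<open>b\<close>, against the fact that the spectral radius of \<open>b\<close> is its norm.

  The same divisibility argument gives \<open>\<parallel>\<langle>x, x\<rangle>\<^sub>L\<parallel> \<le> \<parallel>\<langle>x, x\<rangle>\<^sub>R\<parallel>\<close> and the Cauchy-Schwarz inequality,
  so that positivity of \<open>b\<^sup>* b\<close> is never needed. The algebra has no unit, and an element
  \<open>\<alpha> 1 + \<sigma>\<close> of its unitization is represented by the operator \<open>y \<mapsto> \<alpha> y + \<sigma> y\<close>.\<close>

section \<open>Elementary identities for the involution and the norm\<close>

lemma star_zero [simp]: "star (0::'a::cstar_algebra) = 0"
  using star_add[of "0::'a" 0] by simp

lemma star_minus [simp]: "star (- x) = - star (x::'a::cstar_algebra)"
  using star_add[of x "- x"] by (simp add: eq_neg_iff_add_eq_0 add.commute)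

lemma star_diff: "star (x - y) = star x - star (y::'a::cstar_algebra)"
  using star_add[of x "- y"] by simp

lemma star_scaleR [simp]: "star (r *\<^sub>R x) = r *\<^sub>R star (x::'a::cstar_algebra)"
  by (simp add: scaleR_scaleC star_scaleC)

lemma norm_le_norm_star: "norm x \<le> norm (star (x::'a::cstar_algebra))"
proof (cases "norm x = 0")
  case False
  have "norm x * norm x \<le> norm (star x) * norm x"
    using norm_mult_ineq[of "star x" x] by (simp add: cstar_identity power2_eq_square)
  with False show ?thesis by simp
qed simp

lemma norm_star [simp]: "norm (star x) = norm (x::'a::cstar_algebra)"
  using norm_le_norm_star[of x] norm_le_norm_star[of "star x"] by (simp add: star_star)

lemma norm_mult_star: "norm (x * star x) = (norm (x::'a::cstar_algebra))\<^sup>2"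
  using cstar_identity[of "star x"] by (simp add: star_star)

lemma bounded_linear_star: "bounded_linear (star :: 'a::cstar_algebra \<Rightarrow> 'a)"
  by (rule bounded_linear_intro[where K=1]) (simp_all add: star_add)

lemmas continuous_on_star [continuous_intros] =
  bounded_linear.continuous_on[OF bounded_linear_star]

text \<open>Testing on \<open>y = star c\<close> recovers the norm of \<open>c\<close> from its left
  multiplication operator. In the absence of a unit this is how operator bounds become norm
  bounds.\<close>

lemma norm_le_if_mult_bound:
  fixes c :: "'a::cstar_algebra"
  assumes "0 \<le> K" and "\<And>y. norm (c * y) \<le> K * norm y"
  shows "norm c \<le> K"
proof (cases "c = 0")
  case False
  have "norm c * norm c \<le> K * norm c"
    using assms(2)[of "star c"] by (simp add: norm_mult_star power2_eq_square)
  with False show ?thesis by simp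
qed (use assms in simp)

section \<open>Square roots of contractions\<close>

text \<open>A pair \<open>(a, s)\<close> encodes \<open>a 1 + s\<close> in the unitization. One step
  halves the sum of \<open>\<alpha> 1 + \<sigma>\<close> and the square of the current
  element.\<close>

fun sqrt_iter :: "real \<Rightarrow> 'a::real_normed_algebra \<Rightarrow> nat \<Rightarrow> real \<times> 'a" where
  "sqrt_iter \<alpha> \<sigma> 0 = (0, 0)"
| "sqrt_iter \<alpha> \<sigma> (Suc n) =
    (let (a, s) = sqrt_iter \<alpha> \<sigma> n
     in ((\<alpha> + a\<^sup>2) / 2, (1/2) *\<^sub>R (\<sigma> + (2 * a) *\<^sub>R s + s * s)))"

lemma summable_diff_convergent:
  fixes X :: "nat \<Rightarrow> 'a::banach"
  assumes "\<And>n. norm (X (Suc n) - X n) \<le> q (Suc n) - q n" and "convergent q"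
  shows "convergent X"
proof -
  obtain l where "q \<longlonglongrightarrow> l"
    using assms(2) by (auto simp: convergent_def)
  then have "summable (\<lambda>n. q (Suc n) - q n)"
    by (rule telescope_summable)
  then have "summable (\<lambda>n. X (Suc n) - X n)"
    by (rule summable_comparison_test') (use assms(1) in auto)
  then have "(\<lambda>n. X n - X 0) \<longlonglongrightarrow> (\<Sum>n. X (Suc n) - X n)"
    using summable_LIMSEQ by (fastforce simp: sum_lessThan_telescope)
  from tendsto_add[OF this tendsto_const[of "X 0"]] show ?thesis
    by (auto simp: convergent_def)
qed

text \<open>If \<open>\<alpha> + \<sigma>\<close> is a contraction, the iteration \<open>s \<mapsto> (\<alpha> + \<sigma> + s\<^sup>2) / 2\<close> converges to \<open>s\<close> with
  \<open>(1 - s)\<^sup>2 = 1 - \<alpha> - \<sigma>\<close>, because its increments are bounded by those of the scalar iteration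
  \<open>q \<mapsto> (1 + q\<^sup>2) / 2\<close>, which increases to \<open>1\<close>.\<close>

lemma contraction_sqrt:
  fixes \<sigma> :: "'a::cstar_algebra"
  assumes \<alpha>: "0 \<le> \<alpha>" "\<alpha> \<le> 1"
    and contr: "\<And>y. norm (\<alpha> *\<^sub>R y + \<sigma> * y) \<le> norm y"
    and S: "subspace S" "closed S" "\<And>x. x \<in> S \<Longrightarrow> x * x \<in> S" "\<sigma> \<in> S"
  obtains \<tau> where "\<tau> \<in> S" and "(2 * sqrt (1 - \<alpha>)) *\<^sub>R \<tau> = \<sigma> + \<tau> * \<tau>"
    and "\<And>y. norm (y - sqrt (1 - \<alpha>) *\<^sub>R y + \<tau> * y) \<le> norm y"
proof -
  \<comment> \<open>The scalar majorant is the same iteration with \<open>\<alpha> = 1\<close> and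
    \<open>\<sigma> = 0\<close>.\<close>
  define q where "q = (\<lambda>n. fst (sqrt_iter 1 (0::'a) n))"
  define a where "a = (\<lambda>n. fst (sqrt_iter \<alpha> \<sigma> n))"
  define s where "s = (\<lambda>n. snd (sqrt_iter \<alpha> \<sigma> n))"
  \<comment> \<open>Left multiplication by \<open>a n 1 + s n\<close>, the form in which norms in
    the unitization are estimated.\<close>
  define L where "L = (\<lambda>n y. a n *\<^sub>R y + s n * y)"
  have q0: "q 0 = 0" and qS: "q (Suc n) = (1 + (q n)\<^sup>2) / 2" for n
    by (simp_all add: q_def case_prod_beta)
  have a0: "a 0 = 0" and aS: "a (Suc n) = (\<alpha> + (a n)\<^sup>2) / 2" for n
    by (simp_all add: a_def case_prod_beta)
  have s0: "s 0 = 0" and sS: "s (Suc n) = (1/2) *\<^sub>R (\<sigma> + (2 * a n) *\<^sub>R s n + s n * s n)" for n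
    by (simp_all add: s_def a_def case_prod_beta)
  have q: "0 \<le> q n \<and> q n \<le> 1" for n
    by (induction n) (auto simp: q0 qS power_le_one)
  have a: "0 \<le> a n \<and> a n \<le> q n" for n
  proof (induction n)
    case (Suc n)
    then show ?case using \<alpha> by (auto simp: aS qS intro!: add_mono power_mono)
  qed (simp add: a0 q0)
  have q_diff: "q (Suc (Suc n)) - q (Suc n) = (q (Suc n) + q n) * (q (Suc n) - q n) / 2" for n
    unfolding qS[of "Suc n"] by (subst (2) qS) (simp add: power2_eq_square field_simps)
  have q_mono: "q n \<le> q (Suc n)" for n
    using sum_power2_ge_zero[of "1 - q n" 0] by (simp add: qS power2_eq_square field_simps)
  have a_diff: "\<bar>a (Suc n) - a n\<bar> \<le> q (Suc n) - q n" for n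
  proof (induction n)
    case (Suc n)
    have "\<bar>a (Suc (Suc n)) - a (Suc n)\<bar> = \<bar>(a (Suc n) + a n) * (a (Suc n) - a n) / 2\<bar>"
      by (rule arg_cong[of _ _ abs], unfold aS[of "Suc n"], subst (2) aS)
        (simp add: power2_eq_square field_simps)
    also have "\<dots> = (a (Suc n) + a n) * \<bar>a (Suc n) - a n\<bar> / 2"
      using a[of n] a[of "Suc n"] by (simp add: abs_mult)
    also have "\<dots> \<le> (q (Suc n) + q n) * (q (Suc n) - q n) / 2"
      using a[of n] a[of "Suc n"] q[of n] q[of "Suc n"] Suc
      by (intro divide_right_mono mult_mono add_mono) auto
    finally show ?case unfolding q_diff .
  qed (use \<alpha> in \<open>simp add: a0 q0 aS qS\<close>)
  have L_add: "L n (y + z) = L n y + L n z" and L_diff: "L n (y - z) = L n y - L n z" for n y z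
    by (simp_all add: L_def algebra_simps)
  have LS: "L (Suc n) y = (1/2) *\<^sub>R ((\<alpha> *\<^sub>R y + \<sigma> * y) + L n (L n y))" for n y
    by (simp add: L_def aS sS algebra_simps power2_eq_square mult.assoc add_divide_distrib)
       (simp flip: scaleR_left.add)
  have L_bound: "norm (L n y) \<le> q n * norm y" for n y
  proof (induction n arbitrary: y)
    case (Suc n)
    have "norm (L n (L n y)) \<le> q n * (q n * norm y)"
      using Suc[of "L n y"] mult_left_mono[OF Suc[of y], of "q n"] q[of n] by simp
    with contr[of y] norm_triangle_ineq[of "\<alpha> *\<^sub>R y + \<sigma> * y" "L n (L n y)"]
    have "norm (L (Suc n) y) \<le> (norm y + q n * (q n * norm y)) / 2"
      unfolding LS norm_scaleR by simp
    also have "\<dots> = q (Suc n) * norm y"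
      by (simp add: qS power2_eq_square algebra_simps)
    finally show ?case .
  qed (simp add: L_def a0 s0 q0)
  have L_diff_bound: "norm (L (Suc n) y - L n y) \<le> (q (Suc n) - q n) * norm y" for n y
  proof (induction n arbitrary: y)
    case 0
    then show ?case using contr[of y] by (simp add: LS) (simp add: L_def a0 s0 qS q0)
  next
    case (Suc n)
    let ?d = "\<lambda>y. L (Suc n) y - L n y"
    \<comment> \<open>A difference of squares split as \<open>A (A - B) + (A - B) B\<close>, which
      is valid for non-commuting operators.\<close>
    have "L (Suc (Suc n)) y - L (Suc n) y = (1/2) *\<^sub>R (L (Suc n) (?d y) + ?d (L n y))"
      unfolding LS[of "Suc n" y] by (subst (3) LS) (simp add: L_diff algebra_simps)
    also have "norm \<dots> \<le> (norm (L (Suc n) (?d y)) + norm (?d (L n y))) / 2"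
      using norm_triangle_ineq[of "L (Suc n) (?d y)" "?d (L n y)"] by simp
    also have "\<dots> \<le> (q (Suc n) * ((q (Suc n) - q n) * norm y) + (q (Suc n) - q n) * (q n * norm y)) / 2"
    proof (intro divide_right_mono add_mono)
      show "norm (L (Suc n) (?d y)) \<le> q (Suc n) * ((q (Suc n) - q n) * norm y)"
        using L_bound[of "Suc n" "?d y"] mult_left_mono[OF Suc[of y], of "q (Suc n)"] q[of "Suc n"]
        by simp
      show "norm (?d (L n y)) \<le> (q (Suc n) - q n) * (q n * norm y)"
        using Suc[of "L n y"] mult_left_mono[OF L_bound[of n y], of "q (Suc n) - q n"] q_mono[of n]
        by simp
    qed simp
    also have "\<dots> = (q (Suc (Suc n)) - q (Suc n)) * norm y"
      unfolding q_diff by (simp add: algebra_simps)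
    finally show ?case .
  qed
  \<comment> \<open>One summand \<open>q (Suc n) - q n\<close> accounts for the operator
    \<open>L\<close>, the second for the scalar part \<open>a\<close> that is subtracted from
    it.\<close>
  have s_diff: "norm (s (Suc n) - s n) \<le> 2 * q (Suc n) - 2 * q n" for n
  proof (rule norm_le_if_mult_bound)
    fix y
    have "(s (Suc n) - s n) * y = (L (Suc n) y - L n y) - (a (Suc n) - a n) *\<^sub>R y"
      by (simp add: L_def algebra_simps)
    also have "norm \<dots> \<le> norm (L (Suc n) y - L n y) + \<bar>a (Suc n) - a n\<bar> * norm y"
      by (metis norm_scaleR norm_triangle_ineq4)
    also have "\<dots> \<le> (q (Suc n) - q n) * norm y + (q (Suc n) - q n) * norm y"
      by (intro add_mono mult_right_mono L_diff_bound a_diff) simp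
    finally show "norm ((s (Suc n) - s n) * y) \<le> (2 * q (Suc n) - 2 * q n) * norm y"
      by (simp add: algebra_simps)
  qed (use q_mono in simp)
  have "incseq q"
    using q_mono by (rule incseq_SucI)
  then have q_conv: "convergent q"
    using incseq_convergent[of q 1] q by (metis convergent_def)
  obtain \<beta> where \<beta>: "a \<longlonglongrightarrow> \<beta>"
    using summable_diff_convergent[of a q] a_diff q_conv by (auto simp: convergent_def)
  obtain \<tau> where \<tau>: "s \<longlonglongrightarrow> \<tau>"
    using summable_diff_convergent[of s "\<lambda>n. 2 * q n"] s_diff convergent_mult[OF convergent_const q_conv]
    by (auto simp: convergent_def)
  \<comment> \<open>Of the two roots of \<open>(1 - \<beta>)\<^sup>2 = 1 - \<alpha>\<close> this
    bound selects \<open>\<beta> = 1 - sqrt (1 - \<alpha>)\<close>.\<close>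
  have "\<beta> \<le> 1"
    by (rule LIMSEQ_le_const2[OF \<beta>]) (meson a order_trans q)
  have "(\<lambda>n. a (Suc n)) \<longlonglongrightarrow> (\<alpha> + \<beta>\<^sup>2) / 2"
    unfolding aS by (intro tendsto_intros \<beta>) simp
  with LIMSEQ_Suc[OF \<beta>] have "\<beta> = (\<alpha> + \<beta>\<^sup>2) / 2"
    by (rule LIMSEQ_unique)
  then have "(1 - \<beta>)\<^sup>2 = 1 - \<alpha>"
    by (simp add: power2_eq_square field_simps)
  with \<open>\<beta> \<le> 1\<close> have \<beta>_eq: "\<beta> = 1 - sqrt (1 - \<alpha>)"
    by (metis diff_add_cancel diff_ge_0_iff_ge diff_diff_eq2 add_diff_cancel_left' real_sqrt_unique)
  have s_S: "s n \<in> S" for n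
    by (induction n) (auto simp: s0 sS intro!: subspace_scale subspace_add subspace_0 S)
  have "\<tau> \<in> S"
    using closed_sequentially[OF S(2) _ \<tau>] s_S by blast
  moreover have "(2 * sqrt (1 - \<alpha>)) *\<^sub>R \<tau> = \<sigma> + \<tau> * \<tau>"
  proof -
    have "(\<lambda>n. s (Suc n)) \<longlonglongrightarrow> (1/2) *\<^sub>R (\<sigma> + (2 * \<beta>) *\<^sub>R \<tau> + \<tau> * \<tau>)"
      unfolding sS by (intro tendsto_intros \<beta> \<tau>)
    with LIMSEQ_Suc[OF \<tau>] have "\<tau> = (1/2) *\<^sub>R (\<sigma> + (2 * \<beta>) *\<^sub>R \<tau> + \<tau> * \<tau>)"
      by (rule LIMSEQ_unique)
    then have "2 *\<^sub>R \<tau> = \<sigma> + (2 * \<beta>) *\<^sub>R \<tau> + \<tau> * \<tau>"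
      by (metis scaleR_half_double scaleR_2 scaleR_scaleR mult_2 scaleR_one divide_self_if
          nonzero_mult_div_cancel_left times_divide_eq_right mult.right_neutral zero_neq_numeral)
    then show ?thesis
      by (simp add: \<beta>_eq algebra_simps)
  qed
  moreover have "norm (y - sqrt (1 - \<alpha>) *\<^sub>R y + \<tau> * y) \<le> norm y" for y
  proof -
    have "(\<lambda>n. norm (L n y)) \<longlonglongrightarrow> norm (\<beta> *\<^sub>R y + \<tau> * y)"
      unfolding L_def by (intro tendsto_intros \<beta> \<tau>)
    moreover have "norm (L n y) \<le> norm y" for n
      using L_bound[of n y] q[of n] mult_right_mono[of "q n" 1 "norm y"] by simp
    ultimately have "norm (\<beta> *\<^sub>R y + \<tau> * y) \<le> norm y"
      by (intro LIMSEQ_le_const2) auto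
    then show ?thesis by (simp add: \<beta>_eq algebra_simps)
  qed
  ultimately show thesis by (rule that)
qed

section \<open>Commuting self-adjoint elements and norm estimates from sums of squares\<close>

definition self_adjoint_commuting :: "'a::cstar_algebra set \<Rightarrow> 'a set"
  where "self_adjoint_commuting W = {x. star x = x \<and> (\<forall>w\<in>W. x * w = w * x)}"

lemma self_adjoint_commutingD:
  assumes "x \<in> self_adjoint_commuting W"
  shows "star x = x" and "w \<in> W \<Longrightarrow> x * w = w * x"
  using assms by (auto simp: self_adjoint_commuting_def)

text \<open>These are the conditions that \<open>contraction_sqrt\<close> imposes on
  \<open>S\<close>, so roots can be taken self-adjoint and commuting with \<open>W\<close>. Two
  elements of the set need not commute with each other, so \<open>W\<close> must list everything
  that a root has to commute with.\<close>

lemma self_adjoint_commuting: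
  shows subspace_self_adjoint_commuting: "subspace (self_adjoint_commuting W)"
    and closed_self_adjoint_commuting: "closed (self_adjoint_commuting W)"
    and square_self_adjoint_commuting:
      "x \<in> self_adjoint_commuting W \<Longrightarrow> x * x \<in> self_adjoint_commuting W"
proof -
  show "subspace (self_adjoint_commuting W)"
    by (auto simp: subspace_def self_adjoint_commuting_def star_add algebra_simps)
  have "self_adjoint_commuting W = {x. star x = x} \<inter> (\<Inter>w\<in>W. {x. x * w = w * x})"
    by (auto simp: self_adjoint_commuting_def)
  also have "closed \<dots>"
    by (intro closed_Int closed_INT ballI closed_Collect_eq continuous_intros)
  finally show "closed (self_adjoint_commuting W)" .
  show "x * x \<in> self_adjoint_commuting W" if "x \<in> self_adjoint_commuting W"
    using that by (auto simp: self_adjoint_commuting_def star_mult) (metis mult.assoc)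
qed

text \<open>The cross terms of \<open>star (u + c v) * (u + c v)\<close> carry the factor
  \<open>c + cnj c\<close>, which vanishes for imaginary \<open>c\<close>.\<close>

lemma norm_unitary_combination:
  fixes u v w :: "'a::cstar_algebra"
  assumes "star u * v = star v * u" and "star u * u + star v * v = \<kappa> *\<^sub>R (star w * w)" and "0 \<le> \<kappa>"
    and "c = \<i> \<or> c = - \<i>"
  shows "norm (u + c *\<^sub>C v) = sqrt \<kappa> * norm w"
proof -
  have c: "cnj c = - c" "c * c = -1"
    using assms(4) by auto
  have "star (u + c *\<^sub>C v) * (u + c *\<^sub>C v)
      = star u * u + c *\<^sub>C (star u * v) + (cnj c) *\<^sub>C (star v * u) + (cnj c * c) *\<^sub>C (star v * v)"
    by (simp add: star_add star_scaleC algebra_simps mult_scaleC_left mult_scaleC_right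
        scaleC_add_right scaleC_scaleC)
  also have "\<dots> = star u * u + star v * v + (c + cnj c) *\<^sub>C (star u * v)"
    using c by (simp add: assms(1) scaleC_add_left scaleC_one)
  also have "\<dots> = \<kappa> *\<^sub>R (star w * w)"
    using c by (simp add: assms(2))
  finally have "(norm (u + c *\<^sub>C v))\<^sup>2 = \<kappa> * (norm w)\<^sup>2"
    using assms(3) by (metis abs_of_nonneg cstar_identity norm_scaleR)
  then show ?thesis
    by (metis abs_of_nonneg norm_ge_zero real_sqrt_abs real_sqrt_mult)
qed

text \<open>\<open>u\<close> is the mean of \<open>u + i v\<close> and \<open>u - i v\<close>, both
  of norm \<open>sqrt \<kappa> * norm w\<close>. This replaces the order argument that drops the
  summand \<open>star v * v\<close>.\<close>

lemma norm_le_of_orthogonal_squares: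
  fixes u v w :: "'a::cstar_algebra"
  assumes "star u * v = star v * u" and "star u * u + star v * v = \<kappa> *\<^sub>R (star w * w)" and "0 \<le> \<kappa>"
  shows "norm u \<le> sqrt \<kappa> * norm w"
proof -
  have "2 *\<^sub>R u = (u + \<i> *\<^sub>C v) + (u + (- \<i>) *\<^sub>C v)"
    by (simp add: scaleR_2)
  also have "norm \<dots> \<le> norm (u + \<i> *\<^sub>C v) + norm (u + (- \<i>) *\<^sub>C v)"
    by (rule norm_triangle_ineq)
  also have "\<dots> = 2 * (sqrt \<kappa> * norm w)"
    using norm_unitary_combination[OF assms, of "\<i>"] norm_unitary_combination[OF assms, of "- \<i>"]
    by simp
  finally show ?thesis by simp
qed

text \<open>\<open>1 - b\<^sup>2 = (1 - s)\<^sup>2\<close> for a self-adjoint \<open>s\<close>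
  commuting with \<open>b\<close>. As \<open>(1 - s)\<^sup>2 + b\<^sup>2 = 1\<close>, the factor
  \<open>1 - s\<close> is a contraction, and so is its square.\<close>

lemma norm_diff_square_le:
  fixes b :: "'a::cstar_algebra"
  assumes "star b = b" and "norm b \<le> 1"
  shows "norm (y - b * b * y) \<le> norm y"
proof -
  let ?S = "self_adjoint_commuting {b}"
  have contr: "norm (0 *\<^sub>R y + b * b * y) \<le> norm y" for y
  proof -
    have "norm (b * b * y) \<le> norm (b * b) * norm y"
      by (rule norm_mult_ineq)
    also have "\<dots> \<le> 1 * norm y"
      using norm_mult_ineq[of b b] mult_le_one[OF assms(2) _ assms(2)]
      by (intro mult_right_mono) auto
    finally show ?thesis by simp
  qed
  have "b * b \<in> ?S"
    using assms by (simp add: self_adjoint_commuting_def star_mult mult.assoc)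
  then obtain s where "s \<in> ?S" and "(2 * sqrt (1 - 0)) *\<^sub>R s = b * b + s * s"
    using contraction_sqrt[OF _ _ contr subspace_self_adjoint_commuting
        closed_self_adjoint_commuting square_self_adjoint_commuting, of "{b}"]
    by auto
  then have s: "star s = s" "s * b = b * s" "b * b = 2 *\<^sub>R s - s * s"
    by (auto dest: self_adjoint_commutingD simp: algebra_simps)
  have step: "norm (y - s * y) \<le> norm y" for y
  proof -
    have "norm (y - s * y) \<le> sqrt 1 * norm y"
    proof (rule norm_le_of_orthogonal_squares)
      let ?u = "y - s * y"
      show "star ?u * (b * y) = star (b * y) * ?u"
        using s by (simp add: star_mult star_diff assms(1) algebra_simps)
          (metis mult.assoc)
      have "star (b * y) * (b * y) = star y * (b * b) * y"
        by (simp add: star_mult assms(1) mult.assoc)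
      then show "star ?u * ?u + star (b * y) * (b * y) = 1 *\<^sub>R (star y * y)"
        using s(1) unfolding s(3) by (simp add: star_mult star_diff algebra_simps scaleR_2)
    qed simp
    then show ?thesis by simp
  qed
  have "y - b * b * y = (y - s * y) - s * (y - s * y)"
    unfolding s(3) by (simp add: algebra_simps scaleR_2)
  also have "norm \<dots> \<le> norm y"
    using step order_trans by blast
  finally show ?thesis .
qed

text \<open>The case \<open>\<alpha> = 1\<close>, \<open>\<sigma> = - h\<close> of
  \<open>contraction_sqrt\<close>: the coefficient \<open>sqrt (1 - \<alpha>)\<close> vanishes, so
  the root lies in the algebra itself. Its sign is flipped so that \<open>1 - k\<close> is again a
  contraction and the extraction can be repeated.\<close>

lemma root_exists:
  fixes h :: "'a::cstar_algebra"
  assumes contr: "\<And>y. norm (y - h * y) \<le> norm y"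
    and S: "subspace S" "closed S" "\<And>x. x \<in> S \<Longrightarrow> x * x \<in> S" "h \<in> S"
  obtains k where "k \<in> S" and "k * k = h" and "\<And>y. norm (y - k * y) \<le> norm y"
proof -
  have "norm (1 *\<^sub>R y + - h * y) \<le> norm y" for y
    using contr[of y] by simp
  from contraction_sqrt[OF _ _ this S(1-3)] subspace_neg[OF S(1,4)]
  obtain t where "t \<in> S" "- h + t * t = 0" "\<And>y. norm (y + t * y) \<le> norm y"
    by auto
  with that[of "- t"] subspace_neg[OF S(1)] show thesis
    by (auto simp: algebra_simps)
qed

section \<open>Spectra of self-adjoint elements\<close>

text \<open>\<open>1\<close> is in the spectrum of \<open>b\<^sup>2\<close>: the hypothesis on \<open>e\<close> says that \<open>1 + e\<close> is a left
  inverse of \<open>1 - b\<^sup>2\<close>. With \<open>1 - b\<^sup>2 = (1 - s)\<^sup>2\<close> and \<open>1 - (1 + e) / C = (\<gamma> - t)\<^sup>2\<close> one gets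
  \<open>b\<^sup>2 + ((1 - s) (\<gamma> - t))\<^sup>2 = \<gamma>\<^sup>2 < 1\<close>.\<close>

lemma no_left_quasi_inverse:
  fixes b e :: "'a::cstar_algebra"
  assumes b: "star b = b" "norm b = 1" and e: "e - e * (b * b) = b * b"
  shows False
proof -
  define p where "p = b * b"
  \<comment> \<open>As an operator \<open>1 + e\<close> has norm at most \<open>C\<close>, so
    division by \<open>C\<close> gives a contraction with scalar part \<open>1 / C\<close>.\<close>
  define C where "C = 1 + norm e"
  define \<gamma> where "\<gamma> = sqrt (1 - 1 / C)"
  have p: "star p = p" "norm p = 1" "p * b = b * p"
    using b norm_mult_star[of b] by (simp_all add: p_def star_mult mult.assoc)
  have ep: "e - e * p = p"
    using e by (simp add: p_def)
  from arg_cong[OF ep, of star] have sep: "star e - p * star e = p"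
    by (simp add: star_diff star_mult p)
  \<comment> \<open>Both sides are values of \<open>e (1 - p) star e\<close>. Together with
    \<open>ep\<close> and \<open>sep\<close> this forces \<open>e\<close> to be
    self-adjoint.\<close>
  have "e * p = p * star e"
  proof -
    have "e * p = e * (star e - p * star e)" by (simp add: sep)
    also have "\<dots> = (e - e * p) * star e" by (simp add: algebra_simps)
    finally show ?thesis by (simp add: ep)
  qed
  with ep sep have e_sa: "star e = e"
    by (metis add_diff_cancel diff_add_cancel)
  have pe: "p * e = e * p"
    using \<open>e * p = p * star e\<close> e_sa by simp
  have eb: "e * b = b * e"
  proof -
    \<comment> \<open>\<open>w p = w\<close> says that right multiplication by \<open>1 - p\<close>
      annihilates the commutator \<open>w\<close>. Since \<open>1 - p\<close> has the inverse
      \<open>1 + e\<close>, \<open>w\<close> vanishes.\<close>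
    define w where "w = b * e - e * b"
    have ep': "e * p = e - p"
      using ep by (simp add: algebra_simps)
    have "w * p = b * (e * p) - (e * p) * b"
      using p(3) by (simp add: w_def algebra_simps)
    also have "\<dots> = w"
      using p(3) by (simp add: ep' w_def algebra_simps)
    finally have wp: "w * p = w" .
    have "w = w * e - w * (p * e)"
      using wp by (metis (no_types, lifting) ep' pe right_diff_distrib diff_diff_eq2 add_diff_cancel_left')
    also have "\<dots> = 0"
      using wp by (simp flip: mult.assoc)
    finally show ?thesis by (simp add: w_def)
  qed
  have C: "C > 0" "1 / C \<le> 1" "0 \<le> 1 / C"
    using norm_ge_zero[of e] by (simp_all add: C_def field_simps add_pos_nonneg)
  have \<gamma>: "0 \<le> \<gamma>" "\<gamma> < 1" "\<gamma> * \<gamma> = 1 - 1 / C"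
    using C by (simp_all add: \<gamma>_def)
  let ?S1 = "self_adjoint_commuting {b, e}"
  have contr1: "norm (0 *\<^sub>R y + p * y) \<le> norm y" for y
    using norm_mult_ineq[of p y] p(2) by simp
  have "p \<in> ?S1"
    using p pe by (auto simp: self_adjoint_commuting_def)
  from contraction_sqrt[OF _ _ contr1 subspace_self_adjoint_commuting
      closed_self_adjoint_commuting square_self_adjoint_commuting this]
  obtain s where "s \<in> ?S1" "2 *\<^sub>R s = p + s * s"
    by auto
  then have s: "star s = s" "s * b = b * s" "s * e = e * s" "s * s = 2 *\<^sub>R s - p"
    by (auto dest: self_adjoint_commutingD simp: algebra_simps)
  let ?S2 = "self_adjoint_commuting {b, s}"
  have contr2: "norm ((1/C) *\<^sub>R y + ((1/C) *\<^sub>R e) * y) \<le> norm y" for y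
  proof -
    have "norm ((1/C) *\<^sub>R y + ((1/C) *\<^sub>R e) * y) = norm (y + e * y) / C"
      using C(1) by (simp flip: scaleR_add_right)
    also have "\<dots> \<le> (norm y + norm e * norm y) / C"
      using norm_triangle_ineq[of y "e * y"] norm_mult_ineq[of e y] C(1)
      by (intro divide_right_mono) auto
    also have "\<dots> = norm y"
      using C(1) by (simp add: C_def field_simps)
    finally show ?thesis .
  qed
  have "(1/C) *\<^sub>R e \<in> ?S2"
    using e_sa eb s(3) by (auto simp: self_adjoint_commuting_def)
  from contraction_sqrt[OF C(3,2) contr2 subspace_self_adjoint_commuting
      closed_self_adjoint_commuting square_self_adjoint_commuting this]
  obtain t where "t \<in> ?S2" "(2 * \<gamma>) *\<^sub>R t = (1/C) *\<^sub>R e + t * t"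
    by (auto simp: \<gamma>_def)
  then have t: "star t = t" "t * b = b * t" "t * s = s * t" "t * t = (2 * \<gamma>) *\<^sub>R t - (1/C) *\<^sub>R e"
    by (auto dest: self_adjoint_commutingD simp: algebra_simps)
  have left_commute: "x * (y * z) = y * (x * z)" if "x * y = y * x" for x y z :: 'a
    using that by (metis mult.assoc)
  \<comment> \<open>\<open>v = (\<gamma> - t) b\<close> and
    \<open>d = (1 - s) (\<gamma> - t) b\<close>: the identity for \<open>\<gamma>\<^sup>2\<close> is
    multiplied by \<open>b\<close> to remain in the algebra.\<close>
  define v where "v = \<gamma> *\<^sub>R b - t * b"
  define d where "d = v - s * v"
  have v: "star v = v" "v * s = s * v" "v * b = b * v"
    using s t left_commute[OF t(2)]
    by (simp_all add: v_def star_diff star_mult b algebra_simps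
        left_commute[OF s(2)] left_commute[OF t(2)] left_commute[OF t(3)])
  have vp: "v * p = p * v"
    using v(3) by (simp add: p_def) (metis mult.assoc)
  have "v * v = (\<gamma> * \<gamma>) *\<^sub>R p - ((2 * \<gamma>) *\<^sub>R t - t * t) * p"
    using left_commute[OF t(2)] by (simp add: v_def p_def algebra_simps t(2) scaleR_2)
      (simp flip: scaleR_add_left)
  also have "\<dots> = (1 - 1/C) *\<^sub>R p - (1/C) *\<^sub>R (e * p)"
    unfolding t(4) \<gamma>(3) by (simp add: algebra_simps)
  also have ep': "e * p = e - p"
    using ep by (simp add: algebra_simps)
  finally have vv: "v * v = (1 - 1/C) *\<^sub>R p - (1/C) *\<^sub>R (e - p)" .
  have "star d * d = v * v - (2 *\<^sub>R s - s * s) * (v * v)"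
    using left_commute[OF v(2)] by (simp add: d_def star_diff star_mult v(1,2) s(1) algebra_simps scaleR_2)
  also have "\<dots> = v * v - p * (v * v)"
    by (simp add: s(4))
  also have "\<dots> = (1 - 1/C) *\<^sub>R p - p * p"
    by (simp add: vv algebra_simps pe ep')
  finally have dd: "star d * d = (\<gamma> * \<gamma>) *\<^sub>R p - p * p"
    by (simp add: \<gamma>(3))
  \<comment> \<open>Here \<open>p = b b\<close> and \<open>d\<close> are the two orthogonal terms,
    and the result is \<open>1 = norm p \<le> \<gamma> < 1\<close>.\<close>
  have "norm p \<le> sqrt (\<gamma> * \<gamma>) * norm b"
  proof (rule norm_le_of_orthogonal_squares)
    have sp: "s * p = p * s"
      using s(2) by (simp add: p_def) (metis mult.assoc)
    show "star p * d = star d * p"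
      by (simp add: p d_def star_diff star_mult v s(1) algebra_simps vp)
        (metis mult.assoc sp v(2) vp)
    show "star p * p + star d * d = (\<gamma> * \<gamma>) *\<^sub>R (star b * b)"
      by (simp add: dd p(1) b(1) flip: p_def)
  qed simp
  with p(2) b(2) \<gamma>(1,2) show False by simp
qed

text \<open>The hypothesis says that \<open>h\<close> is a left multiple of \<open>\<parallel>h\<parallel>\<^sup>2 - h\<^sup>2\<close>.\<close>

lemma self_adjoint_resolvent_eq_0:
  fixes h g :: "'a::cstar_algebra"
  assumes h: "star h = h" and g: "(norm h)\<^sup>2 *\<^sub>R h = (norm h)\<^sup>2 *\<^sub>R g - g * (h * h)"
  shows "h = 0"
proof (rule ccontr)
  assume "h \<noteq> 0"
  define r where "r = 1 / norm h"
  have r: "r\<^sup>2 * (norm h)\<^sup>2 = 1"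
    using \<open>h \<noteq> 0\<close> by (simp add: r_def power_divide)
  have "h = r\<^sup>2 *\<^sub>R ((norm h)\<^sup>2 *\<^sub>R h)"
    by (simp add: r)
  also have "\<dots> = g - r\<^sup>2 *\<^sub>R (g * (h * h))"
    by (simp add: g scaleR_diff_right r)
  finally have hg: "h = g - r\<^sup>2 *\<^sub>R (g * (h * h))" .
  \<comment> \<open>\<open>r h\<close> has norm \<open>1\<close>. Multiplying \<open>hg\<close> from
    the left by \<open>r\<^sup>2 h\<close> shows that \<open>r\<^sup>2 h g\<close> is a left
    quasi-inverse for its square.\<close>
  show False
  proof (rule no_left_quasi_inverse)
    show "star (r *\<^sub>R h) = r *\<^sub>R h" "norm (r *\<^sub>R h) = 1"
      using h \<open>h \<noteq> 0\<close> by (simp_all add: r_def)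
    have "r\<^sup>2 *\<^sub>R (h * h) = r\<^sup>2 *\<^sub>R (h * (g - r\<^sup>2 *\<^sub>R (g * (h * h))))"
      by (subst (2) hg) simp
    then show "r\<^sup>2 *\<^sub>R (h * g) - r\<^sup>2 *\<^sub>R (h * g) * (r *\<^sub>R h * r *\<^sub>R h) = r *\<^sub>R h * r *\<^sub>R h"
      by (simp add: algebra_simps power2_eq_square)
  qed
qed

section \<open>Resolvents as fixed points of contractions\<close>

lemma norm_self_adjoint_square: "star h = h \<Longrightarrow> norm (h * h) = (norm (h::'a::cstar_algebra))\<^sup>2"
  using cstar_identity[of h] by simp

text \<open>\<open>1 + u\<close> is \<open>m (m - K)^-1\<close>. The fixed point is sought in the
  commutant of \<open>K\<close>, so that it solves both one-sided equations.\<close>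

lemma Neumann_resolvent:
  fixes K :: "'a::{real_normed_algebra, banach}"
  assumes "norm K < m"
  obtains u where "m *\<^sub>R u - K * u = K" and "m *\<^sub>R u - u * K = K"
proof -
  have m: "m > 0"
    using assms norm_ge_zero[of K] by linarith
  let ?S = "{u. u * K = K * u}"
  let ?f = "\<lambda>u. (1/m) *\<^sub>R (K + K * u)"
  have "\<exists>!u\<in>?S. ?f u = u"
  proof (rule Banach_fix)
    show "complete ?S"
      unfolding complete_eq_closed by (intro closed_Collect_eq continuous_intros)
    show "?S \<noteq> {}"
      by (auto intro: exI[of _ 0])
    show "0 \<le> norm K / m" "norm K / m < 1"
      using m assms by simp_all
    show "?f ` ?S \<subseteq> ?S"
      by (auto simp: algebra_simps)
    show "dist (?f u) (?f v) \<le> norm K / m * dist u v" if "u \<in> ?S" "v \<in> ?S" for u v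
    proof -
      have "?f u - ?f v = (1/m) *\<^sub>R (K * (u - v))"
        by (simp add: algebra_simps)
      then show ?thesis
        using m norm_mult_ineq[of K "u - v"] by (simp add: dist_norm divide_right_mono)
    qed
  qed
  then obtain u where u: "u * K = K * u" "(1/m) *\<^sub>R (K + K * u) = u"
    by auto
  have "m *\<^sub>R u = m *\<^sub>R (1/m) *\<^sub>R (K + K * u)"
    by (simp add: u(2))
  with m have "m *\<^sub>R u = K + K * u"
    by simp
  then have "m *\<^sub>R u - K * u = K" "m *\<^sub>R u - u * K = K"
    unfolding u(1) by (simp_all only: add_diff_cancel)
  then show thesis by (rule that)
qed

text \<open>\<open>w\<close> is \<open>j (j + \<epsilon>)^-1\<close>, the fixed point of
  \<open>w \<mapsto> (j + (1 - j) w) / (1 + \<epsilon>)\<close>. Its bound does not depend on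
  \<open>\<epsilon>\<close> because \<open>1 - w\<close> is a contraction.\<close>

lemma contraction_resolvent:
  fixes j :: "'a::cstar_algebra"
  assumes contr: "\<And>y. norm (y - j * y) \<le> norm y" and \<epsilon>: "0 < \<epsilon>"
    and j: "j \<in> self_adjoint_commuting W"
  obtains w where "w \<in> self_adjoint_commuting (insert j W)" and "j * w + \<epsilon> *\<^sub>R w = j"
    and "norm w \<le> 2"
proof -
  let ?S = "self_adjoint_commuting (insert j W)"
  let ?f = "\<lambda>w. (1 / (1 + \<epsilon>)) *\<^sub>R (j + (w - j * w))"
  have "\<exists>!w\<in>?S. ?f w = w"
  proof (rule Banach_fix)
    show "complete ?S"
      unfolding complete_eq_closed by (rule closed_self_adjoint_commuting)
    show "?S \<noteq> {}"
      using subspace_0[OF subspace_self_adjoint_commuting] by blast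
    show "0 \<le> 1 / (1 + \<epsilon>)" "1 / (1 + \<epsilon>) < 1"
      using \<epsilon> by simp_all
    show "?f ` ?S \<subseteq> ?S"
    proof (clarify intro!: subspace_scale[OF subspace_self_adjoint_commuting])
      fix w assume w: "w \<in> ?S"
      have "j * w * v = v * (j * w)" if "v \<in> insert j W" for v
      proof -
        have "j * v = v * j" "w * v = v * w"
          using that j w by (auto dest: self_adjoint_commutingD)
        then show ?thesis by (metis mult.assoc)
      qed
      moreover have "star (j * w) = j * w" "j \<in> ?S"
        using j w by (auto simp: self_adjoint_commuting_def star_mult)
      ultimately have "j * w \<in> ?S"
        by (simp add: self_adjoint_commuting_def)
      with w \<open>j \<in> ?S\<close> show "j + (w - j * w) \<in> ?S"
        by (intro subspace_add subspace_diff subspace_self_adjoint_commuting)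
    qed
    show "dist (?f u) (?f v) \<le> 1 / (1 + \<epsilon>) * dist u v" if "u \<in> ?S" "v \<in> ?S" for u v
    proof -
      have "?f u - ?f v = (1 / (1 + \<epsilon>)) *\<^sub>R ((u - v) - j * (u - v))"
        by (simp add: algebra_simps)
      then show ?thesis
        using \<epsilon> contr[of "u - v"] by (simp add: dist_norm divide_right_mono)
    qed
  qed
  then obtain w where w: "w \<in> ?S" "?f w = w"
    by auto
  have "(1 + \<epsilon>) *\<^sub>R w = (1 + \<epsilon>) *\<^sub>R ?f w"
    by (simp only: w(2))
  also have "\<dots> = j + (w - j * w)"
    using \<epsilon> by simp
  finally have jw: "j * w + \<epsilon> *\<^sub>R w = j"
    by (simp add: algebra_simps)
  have "norm w \<le> 2"
  proof (rule norm_le_if_mult_bound)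
    fix y
    let ?v = "y - w * y"
    have "(1 + \<epsilon>) *\<^sub>R ?v = \<epsilon> *\<^sub>R y + (?v - j * ?v)"
      using arg_cong[OF jw, of "\<lambda>x. x * y"] by (simp add: algebra_simps)
    then have "(1 + \<epsilon>) * norm ?v \<le> \<epsilon> * norm y + norm ?v"
      using norm_triangle_ineq[of "\<epsilon> *\<^sub>R y" "?v - j * ?v"] contr[of ?v] \<epsilon>
      by (smt (verit) norm_scaleR)
    then have "norm ?v \<le> norm y"
      using \<epsilon> by (simp add: algebra_simps)
    then show "norm (w * y) \<le> 2 * norm y"
      using norm_triangle_ineq2[of "w * y" y] by (simp add: norm_minus_commute)
  qed simp
  with w(1) jw show thesis by (rule that)
qed

section \<open>Hilbert modules\<close>

lemma scaleC_zero_right [simp]: "c *\<^sub>C (0::'a::complex_vector) = 0"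
  by (rule complex_vector.scale_zero_right)

lemma bounded_linear_scaleC: "bounded_linear (\<lambda>x::'a::cstar_algebra. c *\<^sub>C x)"
  by (rule bounded_linear_intro[where K="cmod c"])
    (simp_all add: scaleC_add_right scaleR_scaleC scaleC_scaleC mult.commute norm_scaleC)

lemma csubspace_imp_subspace: "csubspace S \<Longrightarrow> subspace S"
  by (auto simp: subspace_def complex_vector.subspace_def scaleR_scaleC)

lemma csubspace_diff: "csubspace S \<Longrightarrow> x \<in> S \<Longrightarrow> y \<in> S \<Longrightarrow> x - y \<in> S"
  by (rule complex_vector.subspace_diff)

lemma csubspace_closure:
  assumes "csubspace (S :: 'a::cstar_algebra set)"
  shows "csubspace (closure S)"
proof -
  have "0 \<in> closure S"
    using assms closure_subset by (auto simp: complex_vector.subspace_def)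
  moreover have "x + y \<in> closure S" if "x \<in> closure S" "y \<in> closure S" for x y
  proof -
    obtain X Y where "\<forall>n. X n \<in> S" "X \<longlonglongrightarrow> x" "\<forall>n. Y n \<in> S" "Y \<longlonglongrightarrow> y"
      using \<open>x \<in> closure S\<close> \<open>y \<in> closure S\<close> unfolding closure_sequential by blast
    with assms show ?thesis
      unfolding closure_sequential
      by (intro exI[of _ "\<lambda>n. X n + Y n"])
        (auto intro: tendsto_add complex_vector.subspace_add)
  qed
  moreover have "c *\<^sub>C x \<in> closure S" if "x \<in> closure S" for c x
  proof -
    have "(*\<^sub>C) c ` closure S \<subseteq> closure ((*\<^sub>C) c ` S)"
      by (rule closure_bounded_linear_image_subset[OF bounded_linear_scaleC])
    also have "\<dots> \<subseteq> closure S"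
      using assms by (intro closure_mono) (auto intro: complex_vector.subspace_scale)
    finally show ?thesis using that by blast
  qed
  ultimately show ?thesis
    by (simp add: complex_vector.subspace_def)
qed

lemma bounded_linear_image_closure_mem:
  assumes "bounded_linear f" and "\<And>x. x \<in> S \<Longrightarrow> f x \<in> T" and "x \<in> closure S"
  shows "f x \<in> closure T"
  using closure_bounded_linear_image_subset[OF assms(1), of S] closure_mono[of "f ` S" T] assms(2,3)
  by blast

lemma norm_square_less:
  fixes b :: "'a::real_normed_algebra"
  assumes "norm b < t"
  shows "norm (b * b) < t\<^sup>2"
  using norm_mult_ineq[of b b] power_strict_mono[OF assms norm_ge_zero, of 2]
  by (simp add: power2_eq_square)

context left_hilbert_module
begin

lemma lcarrier_closed [simp]:
  shows "0 \<in> mcarrier M"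
    and "x \<in> mcarrier M \<Longrightarrow> y \<in> mcarrier M \<Longrightarrow> x + y \<in> mcarrier M"
    and "x \<in> mcarrier M \<Longrightarrow> y \<in> mcarrier M \<Longrightarrow> x - y \<in> mcarrier M"
    and "x \<in> mcarrier M \<Longrightarrow> c *\<^sub>C x \<in> mcarrier M"
    and "x \<in> mcarrier M \<Longrightarrow> r *\<^sub>R x \<in> mcarrier M"
    and "x \<in> mcarrier M \<Longrightarrow> a \<rhd> x \<in> mcarrier M"
  using lsubspace csubspace_imp_subspace[OF lsubspace] lact_closed
  by (simp_all add: complex_vector.subspace_def subspace_def complex_vector.subspace_diff)

lemma scaleR_lact: "x \<in> mcarrier M \<Longrightarrow> (r *\<^sub>R a) \<rhd> x = r *\<^sub>R (a \<rhd> x)"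
  and linner_scaleR: "x \<in> mcarrier M \<Longrightarrow> y \<in> mcarrier M \<Longrightarrow>
    linner M (r *\<^sub>R x) y = r *\<^sub>R linner M x y"
  by (simp_all add: scaleR_scaleC scaleC_lact linner_scaleC)

lemma linner_diff:
  "x \<in> mcarrier M \<Longrightarrow> y \<in> mcarrier M \<Longrightarrow> z \<in> mcarrier M \<Longrightarrow>
    linner M (x - y) z = linner M x z - linner M y z"
  using linner_add[of "x - y" y z] by simp

lemma linner_eqI:
  assumes "x \<in> mcarrier M" "y \<in> mcarrier M"
    and "\<And>z. z \<in> mcarrier M \<Longrightarrow> linner M x z = linner M y z"
  shows "x = y"
proof -
  have "linner M (x - y) (x - y) = linner M x (x - y) - linner M y (x - y)"
    by (intro linner_diff lcarrier_closed assms)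
  also have "\<dots> = 0"
    using assms(3)[of "x - y"] lcarrier_closed(3)[OF assms(1,2)] by simp
  finally show ?thesis
    using linner_definite[OF lcarrier_closed(3)[OF assms(1,2)]] by simp
qed

end

context right_hilbert_module
begin

lemma rcarrier_closed [simp]:
  shows "0 \<in> mcarrier M"
    and "x \<in> mcarrier M \<Longrightarrow> y \<in> mcarrier M \<Longrightarrow> x + y \<in> mcarrier M"
    and "x \<in> mcarrier M \<Longrightarrow> y \<in> mcarrier M \<Longrightarrow> x - y \<in> mcarrier M"
    and "x \<in> mcarrier M \<Longrightarrow> c *\<^sub>C x \<in> mcarrier M"
    and "x \<in> mcarrier M \<Longrightarrow> r *\<^sub>R x \<in> mcarrier M"
    and "x \<in> mcarrier M \<Longrightarrow> x \<lhd> a \<in> mcarrier M"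
  using rsubspace csubspace_imp_subspace[OF rsubspace] ract_closed
  by (simp_all add: complex_vector.subspace_def subspace_def complex_vector.subspace_diff)

lemma scaleR_ract: "x \<in> mcarrier M \<Longrightarrow> x \<lhd> (r *\<^sub>R a) = r *\<^sub>R (x \<lhd> a)"
  and ract_scaleR: "x \<in> mcarrier M \<Longrightarrow> (r *\<^sub>R x) \<lhd> a = r *\<^sub>R (x \<lhd> a)"
  and rinner_scaleR: "x \<in> mcarrier M \<Longrightarrow> y \<in> mcarrier M \<Longrightarrow>
    rinner M x (r *\<^sub>R y) = r *\<^sub>R rinner M x y"
  by (simp_all add: scaleR_scaleC ract_scaleC scaleC_ract rinner_scaleC)

lemma ract_diff:
  "x \<in> mcarrier M \<Longrightarrow> y \<in> mcarrier M \<Longrightarrow> (x - y) \<lhd> a = x \<lhd> a - y \<lhd> a"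
  using ract_add[of "x - y" y a] by simp

lemma diff_ract: "x \<in> mcarrier M \<Longrightarrow> x \<lhd> (a - b) = x \<lhd> a - x \<lhd> b"
  using add_ract[of x "a - b" b] by simp

lemma ract_zero: "x \<in> mcarrier M \<Longrightarrow> x \<lhd> 0 = 0"
  using diff_ract[of x 0 0] by simp

lemma rinner_diff:
  "x \<in> mcarrier M \<Longrightarrow> y \<in> mcarrier M \<Longrightarrow> z \<in> mcarrier M \<Longrightarrow>
    rinner M x (y - z) = rinner M x y - rinner M x z"
  using rinner_add[of x "y - z" z] by simp

lemma rinner_diff_left:
  assumes "x \<in> mcarrier M" "y \<in> mcarrier M" "z \<in> mcarrier M"
  shows "rinner M (x - y) z = rinner M x z - rinner M y z"
  using arg_cong[OF rinner_diff[OF assms(3,1,2)], of star] assms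
  by (simp add: star_diff star_rinner)

lemma rinner_left:
  assumes "x \<in> mcarrier M" "y \<in> mcarrier M"
  shows rinner_scaleR_left: "rinner M (r *\<^sub>R x) y = r *\<^sub>R rinner M x y"
    and rinner_ract_left: "rinner M (x \<lhd> a) y = star a * rinner M x y"
  using arg_cong[OF rinner_scaleR[OF assms(2,1), of r], of star]
    arg_cong[OF rinner_ract[OF assms(2,1), of a], of star] assms
  by (simp_all add: star_mult star_rinner)

lemma rinner_eqI:
  assumes "x \<in> mcarrier M" "y \<in> mcarrier M"
    and "\<And>z. z \<in> mcarrier M \<Longrightarrow> rinner M z x = rinner M z y"
  shows "x = y"
proof -
  have "rinner M (x - y) (x - y) = rinner M (x - y) x - rinner M (x - y) y"
    by (intro rinner_diff rcarrier_closed assms)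
  also have "\<dots> = 0"
    using assms(3)[of "x - y"] rcarrier_closed(3)[OF assms(1,2)] by simp
  finally show ?thesis
    using rinner_definite[OF rcarrier_closed(3)[OF assms(1,2)]] by simp
qed

section \<open>The ideal of right inner products\<close>

definition rspan :: "'a set"
  where "rspan = cspan {rinner M x y | x y. x \<in> mcarrier M \<and> y \<in> mcarrier M}"

lemma right_ideal_of_eq: "\<langle>M\<rangle>\<^sub>R = closure rspan"
  by (simp add: right_ideal_of_def rspan_def)

lemma csubspace_rspan: "csubspace rspan"
  unfolding rspan_def by (rule complex_vector.subspace_span)

lemma rinner_in_rspan: "x \<in> mcarrier M \<Longrightarrow> y \<in> mcarrier M \<Longrightarrow> rinner M x y \<in> rspan"
  unfolding rspan_def by (intro complex_vector.span_base) auto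

lemma rspan_induct [consumes 1, case_names subspace rinner]:
  assumes "b \<in> rspan" and "csubspace (Collect P)"
    and "\<And>x y. x \<in> mcarrier M \<Longrightarrow> y \<in> mcarrier M \<Longrightarrow> P (rinner M x y)"
  shows "P b"
  using complex_vector.span_induct[OF assms(1)[unfolded rspan_def], of P] assms(2,3) by auto

lemma rspan_mult_left: "b \<in> rspan \<Longrightarrow> a * b \<in> rspan"
proof (induction rule: rspan_induct)
  case subspace
  show ?case
    using csubspace_rspan
    by (auto simp: complex_vector.subspace_def mult_scaleC_right distrib_left)
next
  case (rinner x y)
  then show ?case
    using rinner_in_rspan[of "x \<lhd> star a" y] by (simp add: rinner_ract_left star_star)
qed

lemma rspan_mult_right: "b \<in> rspan \<Longrightarrow> b * a \<in> rspan"
proof (induction rule: rspan_induct)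
  case subspace
  show ?case
    using csubspace_rspan
    by (auto simp: complex_vector.subspace_def mult_scaleC_left distrib_right)
next
  case (rinner x y)
  then show ?case
    using rinner_in_rspan[of x "y \<lhd> a"] by (simp add: rinner_ract)
qed

lemma rspan_star: "b \<in> rspan \<Longrightarrow> star b \<in> rspan"
proof (induction rule: rspan_induct)
  case subspace
  show ?case
    using csubspace_rspan
    by (auto simp: complex_vector.subspace_def star_add star_scaleC)
qed (simp add: star_rinner rinner_in_rspan)

lemma rinner_in_right_ideal:
  "x \<in> mcarrier M \<Longrightarrow> y \<in> mcarrier M \<Longrightarrow> rinner M x y \<in> \<langle>M\<rangle>\<^sub>R"
  unfolding right_ideal_of_eq using rinner_in_rspan closure_subset by blast

lemma right_ideal_star: "b \<in> \<langle>M\<rangle>\<^sub>R \<Longrightarrow> star b \<in> \<langle>M\<rangle>\<^sub>R"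
  unfolding right_ideal_of_eq
  by (rule bounded_linear_image_closure_mem[OF bounded_linear_star rspan_star])

lemma closed_ideal_right_ideal_of: "closed_ideal \<langle>M\<rangle>\<^sub>R"
  unfolding closed_ideal_def right_ideal_of_eq
  using csubspace_closure[OF csubspace_rspan]
    bounded_linear_image_closure_mem[OF bounded_linear_mult_left rspan_mult_right]
    bounded_linear_image_closure_mem[OF bounded_linear_mult_right rspan_mult_left]
  by simp

lemma right_ideal_closed:
  shows "csubspace \<langle>M\<rangle>\<^sub>R" "closed \<langle>M\<rangle>\<^sub>R" "subspace \<langle>M\<rangle>\<^sub>R"
    and "b \<in> \<langle>M\<rangle>\<^sub>R \<Longrightarrow> a * b \<in> \<langle>M\<rangle>\<^sub>R" "b \<in> \<langle>M\<rangle>\<^sub>R \<Longrightarrow> b * a \<in> \<langle>M\<rangle>\<^sub>R"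
  using closed_ideal_right_ideal_of csubspace_imp_subspace by (auto simp: closed_ideal_def)

text \<open>Every inner product annihilates \<open>b - c\<close> from the left, hence so does the
  whole ideal, which contains \<open>star (b - c)\<close>. The C*-identity then gives
  \<open>b - c = 0\<close>.\<close>

lemma right_ideal_faithful:
  assumes b: "b \<in> \<langle>M\<rangle>\<^sub>R" "c \<in> \<langle>M\<rangle>\<^sub>R" and eq: "\<And>m. m \<in> mcarrier M \<Longrightarrow> m \<lhd> b = m \<lhd> c"
  shows "b = c"
proof -
  let ?d = "b - c"
  have "r * ?d = 0" if "r \<in> rspan" for r
    using that
  proof (induction rule: rspan_induct)
    case (rinner x y)
    then have "rinner M x y * ?d = rinner M x (y \<lhd> b) - rinner M x (y \<lhd> c)"
      by (simp add: rinner_ract algebra_simps)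
    then show ?case using rinner by (simp add: eq)
  qed (auto simp: complex_vector.subspace_def mult_scaleC_left distrib_right)
  then have "r * ?d = 0" if "r \<in> closure rspan" for r
    using bounded_linear_image_closure_mem[OF bounded_linear_mult_left, of rspan ?d "{0}" r] that
    by simp
  moreover have "star ?d \<in> closure rspan"
    using right_ideal_star[OF subspace_diff[OF right_ideal_closed(3) b]] by (simp add: right_ideal_of_eq)
  ultimately show ?thesis
    using cstar_identity[of ?d] by simp
qed

end

section \<open>Norm comparison, Cauchy-Schwarz inequality and factorization in bimodules\<close>

context hilbert_bimodule
begin

text \<open>By \<open>inner_compat\<close> both sides act on \<open>M\<close> from the left in the
  same way, so their difference \<open>D\<close> annihilates every left inner product.
  \<open>star D\<close> is a difference of such products, whence
  \<open>D * star D = 0\<close>.\<close>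

lemma linner_ract:
  assumes [simp]: "x \<in> mcarrier M" "y \<in> mcarrier M"
  shows "linner M (x \<lhd> b) y = linner M x (y \<lhd> star b)"
proof -
  define D where "D = linner M (x \<lhd> b) y - linner M x (y \<lhd> star b)"
  have "linner M (x \<lhd> b) y \<rhd> z = linner M x (y \<lhd> star b) \<rhd> z" if "z \<in> mcarrier M" for z
    using that by (simp add: inner_compat rinner_ract_left star_star mult_ract)
  then have "linner M (x \<lhd> b) y * linner M z w = linner M x (y \<lhd> star b) * linner M z w"
    if "z \<in> mcarrier M" "w \<in> mcarrier M" for z w
    using that by (simp flip: linner_lact)
  moreover have "star D = linner M y (x \<lhd> b) - linner M (y \<lhd> star b) x"
    by (simp add: D_def star_diff star_linner)
  ultimately have "linner M (x \<lhd> b) y * star D = linner M x (y \<lhd> star b) * star D"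
    by (simp add: right_diff_distrib)
  then have "D * star D = 0"
    by (simp add: D_def left_diff_distrib)
  with norm_mult_star[of D] show ?thesis by (simp add: D_def)
qed

text \<open>\<open>a d = d b\<close> links the two inner squares. If \<open>norm b < norm a\<close>,
  then \<open>\<mu> - b\<^sup>2\<close> is invertible, so \<open>\<mu> - a\<^sup>2\<close> divides
  \<open>d\<close> and, after pairing with \<open>d\<close>, also \<open>a\<close>. Then
  \<open>a = 0\<close> by \<open>self_adjoint_resolvent_eq_0\<close>.\<close>

lemma norm_linner_le_rinner:
  assumes [simp]: "d \<in> mcarrier M"
  shows "norm (linner M d d) \<le> norm (rinner M d d)"
proof (rule ccontr)
  define a b where "a = linner M d d" and "b = rinner M d d"
  define \<mu> where "\<mu> = (norm a)\<^sup>2"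
  assume "\<not> ?thesis"
  then have ba: "norm b < norm a"
    by (simp add: a_def b_def)
  have ad: "a \<rhd> d = d \<lhd> b"
    by (simp add: a_def b_def inner_compat)
  have sa: "star a = a"
    by (simp add: a_def star_linner)
  have "norm (b * b) < \<mu>"
    unfolding \<mu>_def by (rule norm_square_less[OF ba])
  then obtain u where u: "\<mu> *\<^sub>R u - b * b * u = b * b" "\<mu> *\<^sub>R u - u * (b * b) = b * b"
    using Neumann_resolvent by blast
  \<comment> \<open>This is \<open>\<mu> d (\<mu> - b\<^sup>2)^-1\<close>, hence
    \<open>(\<mu> - a\<^sup>2) y = \<mu> d\<close>.\<close>
  define y where "y = d + d \<lhd> u"
  have [simp]: "y \<in> mcarrier M"
    by (simp add: y_def)
  have "(a * a) \<rhd> y = d \<lhd> (b * b + b * b * u)"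
    by (simp add: y_def lact_add add_ract mult_lact mult_ract ad flip: act_assoc)
  also have "\<dots> = \<mu> *\<^sub>R y - \<mu> *\<^sub>R d"
    using u(1) by (simp add: y_def scaleR_add_right scaleR_ract[symmetric])
      (metis diff_eq_eq add.commute)
  finally have "linner M ((a * a) \<rhd> y) d = linner M (\<mu> *\<^sub>R y - \<mu> *\<^sub>R d) d"
    by simp
  then have "\<mu> *\<^sub>R a = \<mu> *\<^sub>R linner M y d - a * a * linner M y d"
    by (simp add: linner_lact linner_diff linner_scaleR) (simp add: a_def algebra_simps)
  from arg_cong[OF this, of star]
  have "\<mu> *\<^sub>R a = \<mu> *\<^sub>R star (linner M y d) - star (linner M y d) * (a * a)"
    by (simp add: star_diff star_mult sa)
  then have "a = 0"
    unfolding \<mu>_def by (rule self_adjoint_resolvent_eq_0[OF sa])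
  with ba show False by simp
qed

text \<open>Compatibility of the inner products gives \<open>d h = K d\<close>, and divisibility
  bounds \<open>norm h\<close> by \<open>norm K\<close>. The norm of \<open>linner M d d\<close> in
  this bound is then replaced by that of \<open>rinner M d d\<close>, while \<open>z\<close> enters
  through its left norm.\<close>

lemma norm_rinner_le:
  assumes [simp]: "z \<in> mcarrier M" "d \<in> mcarrier M"
  shows "(norm (rinner M z d))\<^sup>2 \<le> norm (rinner M d d) * norm (linner M z z)"
proof -
  define f h K where "f = rinner M z d" and "h = star f * f" and "K = linner M d d * linner M z z"
  define \<mu> where "\<mu> = (norm h)\<^sup>2"
  have "d \<lhd> h = d \<lhd> rinner M d z \<lhd> rinner M z d"
    by (simp add: h_def f_def star_rinner mult_ract)
  also have "\<dots> = (linner M d d \<rhd> z) \<lhd> rinner M z d"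
    by (simp add: inner_compat)
  also have "\<dots> = linner M d d \<rhd> (z \<lhd> rinner M z d)"
    by (simp add: act_assoc)
  also have "z \<lhd> rinner M z d = linner M z z \<rhd> d"
    by (simp add: inner_compat)
  also have "linner M d d \<rhd> (linner M z z \<rhd> d) = K \<rhd> d"
    by (simp add: K_def mult_lact)
  finally have dh: "d \<lhd> h = K \<rhd> d" .
  have sh: "star h = h"
    by (simp add: h_def star_mult star_star)
  have "norm h \<le> norm K"
  proof (rule ccontr)
    assume "\<not> ?thesis"
    then have "norm K < norm h" by simp
    then have "norm (K * K) < \<mu>"
      unfolding \<mu>_def by (rule norm_square_less)
    then obtain u where u: "\<mu> *\<^sub>R u - u * (K * K) = K * K"
      using Neumann_resolvent by blast
    define y where "y = d + u \<rhd> d"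
    have [simp]: "y \<in> mcarrier M"
      by (simp add: y_def)
    have "y \<lhd> (h * h) = (K * K + u * (K * K)) \<rhd> d"
      by (simp add: y_def ract_add add_lact mult_lact mult_ract act_assoc dh)
    also have "\<dots> = \<mu> *\<^sub>R y - \<mu> *\<^sub>R d"
      using u by (simp add: y_def scaleR_add_right scaleR_lact[symmetric])
        (metis diff_eq_eq add.commute)
    finally have "rinner M z (y \<lhd> (h * h)) = rinner M z (\<mu> *\<^sub>R y - \<mu> *\<^sub>R d)"
      by simp
    \<comment> \<open>Divisibility is obtained for \<open>f\<close> first; the factor
      \<open>star f\<close> carries it over to \<open>h\<close>.\<close>
    then have f: "\<mu> *\<^sub>R f = \<mu> *\<^sub>R rinner M z y - rinner M z y * (h * h)"
      by (simp add: rinner_ract rinner_diff rinner_scaleR) (simp add: f_def algebra_simps)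
    have "\<mu> *\<^sub>R h = star f * (\<mu> *\<^sub>R f)"
      by (simp add: h_def)
    also have "\<dots> = \<mu> *\<^sub>R (star f * rinner M z y) - (star f * rinner M z y) * (h * h)"
      by (subst f) (simp add: algebra_simps)
    finally have "h = 0"
      unfolding \<mu>_def by (rule self_adjoint_resolvent_eq_0[OF sh])
    with \<open>norm K < norm h\<close> show False by simp
  qed
  also have "\<dots> \<le> norm (linner M d d) * norm (linner M z z)"
    unfolding K_def by (rule norm_mult_ineq)
  also have "\<dots> \<le> norm (rinner M d d) * norm (linner M z z)"
    by (intro mult_right_mono norm_linner_le_rinner) simp_all
  finally show ?thesis
    by (simp add: h_def f_def cstar_identity)
qed

text \<open>Cohen factorization with \<open>j\<close> a multiple of \<open>\<bar>b\<bar>\<^sup>1\<^sup>/\<^sup>4\<close> for \<open>b = \<langle>x, x\<rangle>\<close> and \<open>m\<close> the limit of the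
  elements \<open>x (j + \<epsilon>)\<^sup>-\<^sup>1\<close>, which are written as \<open>(x - x w) / \<epsilon>\<close> with \<open>w = j (j + \<epsilon>)\<^sup>-\<^sup>1\<close> since
  there is no unit.\<close>

lemma factorization:
  assumes x [simp]: "x \<in> mcarrier M"
  obtains m j where "m \<in> mcarrier M" and "j \<in> \<langle>M\<rangle>\<^sub>R" and "x = m \<lhd> j"
proof (cases "rinner M x x = 0")
  case True
  then have "x = 0"
    by (rule rinner_definite[OF x])
  then have "x = 0 \<lhd> 0"
    using x by (simp add: ract_zero)
  moreover have "0 \<in> mcarrier M" "0 \<in> \<langle>M\<rangle>\<^sub>R"
    using subspace_0[OF right_ideal_closed(3)] by simp_all
  ultimately show thesis
    using that by blast
next
  case False
  define b where "b = rinner M x x"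
  define \<beta> where "\<beta> = norm b"
  define h where "h = (1 / \<beta>) *\<^sub>R b"
  have \<beta>: "\<beta> > 0"
    using False by (simp add: \<beta>_def b_def)
  have b: "star b = b"
    by (simp add: b_def star_rinner)
  have h: "star h = h" "norm h = 1" "b = \<beta> *\<^sub>R h"
    using \<beta> b by (simp_all add: h_def) (simp add: \<beta>_def)
  \<comment> \<open>Roots taken in this set stay in the ideal and commute with
    \<open>b\<close>.\<close>
  let ?S = "\<langle>M\<rangle>\<^sub>R \<inter> self_adjoint_commuting {b}"
  have S: "subspace ?S" "closed ?S" "\<And>z. z \<in> ?S \<Longrightarrow> z * z \<in> ?S"
    using right_ideal_closed
    by (auto intro!: subspace_inter closed_Int subspace_self_adjoint_commuting
        closed_self_adjoint_commuting square_self_adjoint_commuting)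
  have "h \<in> ?S"
    using b x by (simp add: h_def self_adjoint_commuting_def b_def rinner_in_right_ideal
        subspace_scale[OF right_ideal_closed(3)])
  \<comment> \<open>\<open>norm_diff_square_le\<close> controls \<open>1 - h\<^sup>2\<close>, so
    roots are extracted from \<open>h\<^sup>2\<close>: \<open>k\<close>, \<open>l\<close>,
    \<open>j\<close> play the roles of \<open>\<bar>h\<bar>\<close> and its powers
    \<open>1/2\<close> and \<open>1/4\<close>.\<close>
  then have p: "h * h \<in> ?S" "\<And>y. norm (y - h * h * y) \<le> norm y"
    using S(3) h by (auto intro: norm_diff_square_le)
  obtain k where k: "k \<in> ?S" "k * k = h * h" "\<And>y. norm (y - k * y) \<le> norm y"
    using root_exists[OF p(2) S p(1)] by blast
  obtain l where l: "l \<in> ?S" "l * l = k" "\<And>y. norm (y - l * y) \<le> norm y"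
    using root_exists[OF k(3) S k(1)] by blast
  obtain j where j: "j \<in> ?S" "j * j = l" "\<And>y. norm (y - j * y) \<le> norm y"
    using root_exists[OF l(3) S l(1)] by blast
  have bb: "b * b = \<beta>\<^sup>2 *\<^sub>R (l * l * (l * l))"
    by (simp add: h(3) l(2) k(2) power2_eq_square)
  define \<epsilon> where "\<epsilon> = (\<lambda>n. 1 / (real n + 1))"
  have \<epsilon>: "\<epsilon> n > 0" for n
    by (simp add: \<epsilon>_def)
  have \<epsilon>_0: "\<epsilon> \<longlonglongrightarrow> 0"
    unfolding \<epsilon>_def using LIMSEQ_inverse_real_of_nat by (simp add: inverse_eq_divide add.commute)
  have "\<exists>w. w \<in> self_adjoint_commuting {j, b} \<and> j * w + \<epsilon> n *\<^sub>R w = j \<and> norm w \<le> 2" for n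
    using contraction_resolvent[OF j(3) \<epsilon>] j(1) by blast
  then obtain w where w: "\<And>n. w n \<in> self_adjoint_commuting {j, b}"
      "\<And>n. j * w n + \<epsilon> n *\<^sub>R w n = j" "\<And>n. norm (w n) \<le> 2"
    by metis
  have wj: "w n * j = j * w n" for n
    using w(1) by (auto dest: self_adjoint_commutingD)
  have jw: "j * w n = j - \<epsilon> n *\<^sub>R w n" for n
    using w(2) by (simp add: eq_diff_eq)
  define m where "m = (\<lambda>n. (1 / \<epsilon> n) *\<^sub>R (x - x \<lhd> w n))"
  have m [simp]: "m n \<in> mcarrier M" for n
    by (simp add: m_def)
  have mj: "m n \<lhd> j = x - \<epsilon> n *\<^sub>R m n" for n
  proof -
    have "m n \<lhd> j = (1 / \<epsilon> n) *\<^sub>R (x \<lhd> (j - w n * j))"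
      by (simp add: m_def ract_scaleR ract_diff diff_ract mult_ract)
    also have "\<dots> = x \<lhd> w n"
      using \<epsilon>[of n] by (simp add: wj jw scaleR_ract)
    finally show ?thesis
      using \<epsilon>[of n] by (simp add: m_def)
  qed
  have m_diff: "ip_norm (rinner M) (m n - m i) \<le> 2 * sqrt \<beta> * (\<epsilon> n + \<epsilon> i)" for n i
  proof -
    \<comment> \<open>\<open>\<kappa> - W\<close> is the difference of
      \<open>(j + \<epsilon> n)^-1\<close> and \<open>(j + \<epsilon> i)^-1\<close>, and
      \<open>R\<close> multiplies by it from the right.\<close>
    define \<kappa> where "\<kappa> = 1 / \<epsilon> n - 1 / \<epsilon> i"
    define W where "W = (1 / \<epsilon> n) *\<^sub>R w n - (1 / \<epsilon> i) *\<^sub>R w i"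
    define R where "R = (\<lambda>z. \<kappa> *\<^sub>R z - z * W)"
    define q where "q = \<epsilon> i *\<^sub>R w i - \<epsilon> n *\<^sub>R w n"
    define E where "E = rinner M (m n - m i) (m n - m i)"
    have "W \<in> self_adjoint_commuting {j, b}"
      unfolding W_def using w(1) subspace_self_adjoint_commuting
      by (intro subspace_diff subspace_scale) auto
    then have W: "star W = W" "W * j = j * W" "W * b = b * W"
      by (auto dest: self_adjoint_commutingD)
    have Wl: "W * l = l * W"
      using W(2) by (metis j(2) mult.assoc)
    have D: "m n - m i = \<kappa> *\<^sub>R x - x \<lhd> W"
      by (simp add: m_def \<kappa>_def W_def diff_ract scaleR_ract algebra_simps)
    have "E = R (R b)"
      unfolding E_def D
      by (simp add: rinner_diff rinner_diff_left rinner_scaleR rinner_scaleR_left rinner_ract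
          rinner_ract_left W(1,3) R_def algebra_simps flip: b_def)
    have R1: "z * R z' = R (z * z')" for z z'
      by (simp add: R_def algebra_simps)
    have R2: "R z * z' = R (z * z')" if "W * z' = z' * W" for z z'
      by (simp add: R_def algebra_simps that)
    have R3: "R (c *\<^sub>R z) = c *\<^sub>R R z" for c z
      by (simp add: R_def algebra_simps)
    have "R l = q"
    proof -
      have "j * (j * w r) = l - \<epsilon> r *\<^sub>R j + (\<epsilon> r * \<epsilon> r) *\<^sub>R w r" for r
        by (simp add: jw right_diff_distrib j(2) algebra_simps)
      then have "l * w r = l - \<epsilon> r *\<^sub>R j + (\<epsilon> r * \<epsilon> r) *\<^sub>R w r" for r
        by (simp add: mult.assoc flip: j(2))
      then have lw: "(1 / \<epsilon> r) *\<^sub>R (l * w r) = (1 / \<epsilon> r) *\<^sub>R l - j + \<epsilon> r *\<^sub>R w r" for r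
        using \<epsilon>[of r] by (simp add: scaleR_add_right scaleR_diff_right)
      have "l * W = ((1 / \<epsilon> n) *\<^sub>R l - j + \<epsilon> n *\<^sub>R w n) - ((1 / \<epsilon> i) *\<^sub>R l - j + \<epsilon> i *\<^sub>R w i)"
        by (simp only: W_def right_diff_distrib mult_scaleR_right lw)
      then show ?thesis
        by (simp add: R_def \<kappa>_def q_def algebra_simps)
    qed
    have sE: "star E = E"
      by (simp add: E_def star_rinner)
    \<comment> \<open>\<open>E\<close> is squared because it is \<open>b\<^sup>2\<close> that equals
      \<open>\<beta>\<^sup>2 l\<^sup>4\<close>. Each of the four factors \<open>\<kappa> - W\<close>
      then meets one \<open>l\<close> and gives a \<open>q\<close>, so that
      \<open>E\<^sup>2 = \<beta>\<^sup>2 q\<^sup>4\<close>.\<close>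
    have "E * E = R (R (R (R (b * b))))"
      unfolding \<open>E = R (R b)\<close> by (simp add: R1 R2 W(3))
    also have "\<dots> = \<beta>\<^sup>2 *\<^sub>R R (R (R (R (l * l * (l * l)))))"
      by (simp add: bb R3)
    also have "R (R (R (R (l * l * (l * l))))) = (q * q) * (q * q)"
    proof -
      have "W * (l * l) = l * l * W"
        using Wl by (metis mult.assoc)
      then show ?thesis
        by (simp add: R1 R2 Wl flip: \<open>R l = q\<close>)
    qed
    finally have "norm (E * E) \<le> \<beta>\<^sup>2 * (norm (q * q) * norm (q * q))"
      using norm_mult_ineq[of "q * q" "q * q"] by (simp add: mult_left_mono)
    also have "\<dots> \<le> \<beta>\<^sup>2 * ((norm q)\<^sup>2 * (norm q)\<^sup>2)"
      using norm_mult_ineq[of q q] by (intro mult_left_mono mult_mono) (auto simp: power2_eq_square)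
    finally have "(norm E)\<^sup>2 \<le> (\<beta> * (norm q)\<^sup>2)\<^sup>2"
      by (simp add: norm_self_adjoint_square[OF sE] power_mult_distrib power2_eq_square mult_ac)
    then have "norm E \<le> \<beta> * (norm q)\<^sup>2"
      using \<beta> by (simp add: power2_le_iff_abs_le)
    then have "ip_norm (rinner M) (m n - m i) \<le> sqrt (\<beta> * (norm q)\<^sup>2)"
      by (simp add: ip_norm_def E_def)
    also have "\<dots> = sqrt \<beta> * norm q"
      using \<beta> by (simp add: real_sqrt_mult)
    also have "norm q \<le> \<epsilon> i * norm (w i) + \<epsilon> n * norm (w n)"
      unfolding q_def using norm_triangle_ineq4[of "\<epsilon> i *\<^sub>R w i" "\<epsilon> n *\<^sub>R w n"] \<epsilon>[of i] \<epsilon>[of n]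
      by simp
    also have "\<dots> \<le> \<epsilon> i * 2 + \<epsilon> n * 2"
      using w(3) \<epsilon>[of i] \<epsilon>[of n] by (intro add_mono mult_left_mono) auto
    finally show ?thesis
      using \<beta> by (simp add: algebra_simps)
  qed
  have "\<exists>K. \<forall>n\<ge>K. \<forall>i\<ge>K. ip_norm (rinner M) (m n - m i) < e" if "e > 0" for e
  proof -
    have "(\<lambda>n. 4 * sqrt \<beta> * \<epsilon> n) \<longlonglongrightarrow> 4 * sqrt \<beta> * 0"
      by (intro tendsto_intros \<epsilon>_0)
    then have "\<forall>\<^sub>F n in sequentially. 4 * sqrt \<beta> * \<epsilon> n < e"
      using \<open>e > 0\<close> by (intro order_tendstoD(2)) auto
    then obtain K where K: "4 * sqrt \<beta> * \<epsilon> K < e"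
      by (auto simp: eventually_sequentially)
    have "ip_norm (rinner M) (m n - m i) < e" if "n \<ge> K" "i \<ge> K" for n i
    proof -
      have "\<epsilon> n \<le> \<epsilon> K" "\<epsilon> i \<le> \<epsilon> K"
        using that by (simp_all add: \<epsilon>_def frac_le)
      then have "2 * sqrt \<beta> * (\<epsilon> n + \<epsilon> i) \<le> 2 * sqrt \<beta> * (\<epsilon> K + \<epsilon> K)"
        using \<beta> by (intro mult_left_mono add_mono) auto
      with m_diff[of n i] K show ?thesis by (simp add: algebra_simps)
    qed
    then show ?thesis by blast
  qed
  with rinner_complete m obtain m\<^sub>0
    where m0 [simp]: "m\<^sub>0 \<in> mcarrier M" and lim: "(\<lambda>n. ip_norm (rinner M) (m n - m\<^sub>0)) \<longlonglongrightarrow> 0"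
    unfolding ip_complete_def by blast
  have "x = m\<^sub>0 \<lhd> j"
  proof (rule rinner_eqI)
    fix z assume z [simp]: "z \<in> mcarrier M"
    define d where "d = (\<lambda>n. m n - m\<^sub>0)"
    have d [simp]: "d n \<in> mcarrier M" for n
      by (simp add: d_def)
    have "(\<lambda>n. ip_norm (rinner M) (d n) * sqrt (norm (linner M z z))) \<longlonglongrightarrow> 0 * sqrt (norm (linner M z z))"
      unfolding d_def by (intro tendsto_intros lim)
    \<comment> \<open>The Cauchy-Schwarz inequality turns convergence in the module norm into
      convergence of the inner products with \<open>z\<close>.\<close>
    moreover have "norm (rinner M z (d n)) \<le> ip_norm (rinner M) (d n) * sqrt (norm (linner M z z))" for n
      using real_sqrt_le_mono[OF norm_rinner_le[OF z d]] by (simp add: ip_norm_def real_sqrt_mult)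
    ultimately have zd: "(\<lambda>n. rinner M z (d n)) \<longlonglongrightarrow> 0"
      unfolding mult_zero_left by (rule Lim_null_comparison[OF always_eventually[OF allI], rotated])
    have "rinner M z x - rinner M z (m\<^sub>0 \<lhd> j)
        = rinner M z (d n) * j + \<epsilon> n *\<^sub>R (rinner M z (d n) + rinner M z m\<^sub>0)" for n
    proof -
      have "d n \<lhd> j = x - \<epsilon> n *\<^sub>R m n - m\<^sub>0 \<lhd> j"
        by (simp add: d_def ract_diff mj)
      then have "rinner M z (d n) * j = rinner M z x - \<epsilon> n *\<^sub>R rinner M z (m n) - rinner M z (m\<^sub>0 \<lhd> j)"
        by (simp add: rinner_diff rinner_scaleR flip: rinner_ract)
      then show ?thesis
        by (simp add: d_def rinner_diff)
    qed
    moreover have "(\<lambda>n. rinner M z (d n) * j + \<epsilon> n *\<^sub>R (rinner M z (d n) + rinner M z m\<^sub>0))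
        \<longlonglongrightarrow> 0 * j + 0 *\<^sub>R (0 + rinner M z m\<^sub>0)"
      by (intro tendsto_intros zd \<epsilon>_0)
    ultimately have "(\<lambda>n::nat. rinner M z x - rinner M z (m\<^sub>0 \<lhd> j)) \<longlonglongrightarrow> 0"
      by simp
    then show "rinner M z x = rinner M z (m\<^sub>0 \<lhd> j)"
      by (simp add: LIMSEQ_const_iff)
  qed simp_all
  with j(1) show thesis
    by (intro that[of m\<^sub>0 j]) auto
qed

end

section \<open>Isomorphisms of left modules\<close>

locale left_iso_bimodules =
  bimodule_M: hilbert_bimodule M + bimodule_N: hilbert_bimodule N + left_hilbert_iso M N \<Phi>
  for M :: "('a::cstar_algebra, 'm::complex_vector) bimodule"
    and N :: "('a, 'n::complex_vector) bimodule" and \<Phi>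
begin

abbreviation \<Psi> :: "'n \<Rightarrow> 'm"
  where "\<Psi> \<equiv> inv_into (mcarrier M) \<Phi>"

lemma iso_mem [simp]:
  shows "x \<in> mcarrier M \<Longrightarrow> \<Phi> x \<in> mcarrier N" and "y \<in> mcarrier N \<Longrightarrow> \<Psi> y \<in> mcarrier M"
  using bij bij_betw_inv_into[OF bij] by (auto dest: bij_betwE)

lemma iso_inverse [simp]:
  shows "x \<in> mcarrier M \<Longrightarrow> \<Psi> (\<Phi> x) = x" and "y \<in> mcarrier N \<Longrightarrow> \<Phi> (\<Psi> y) = y"
  using bij by (auto intro: bij_betw_inv_into_left bij_betw_inv_into_right)

lemma iso_eqD: "\<Phi> x = \<Phi> y \<Longrightarrow> x \<in> mcarrier M \<Longrightarrow> y \<in> mcarrier M \<Longrightarrow> x = y"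
  by (metis iso_inverse(1))

lemma iso_diff: "x \<in> mcarrier M \<Longrightarrow> y \<in> mcarrier M \<Longrightarrow> \<Phi> (x - y) = \<Phi> x - \<Phi> y"
  using add[of "x - y" y] by simp

lemma iso_scaleR: "x \<in> mcarrier M \<Longrightarrow> \<Phi> (r *\<^sub>R x) = r *\<^sub>R \<Phi> x"
  by (simp add: scaleR_scaleC scaleC)

section \<open>Intertwined elements: algebra, uniqueness, norms and existence\<close>

definition intertwined :: "'a \<Rightarrow> 'a \<Rightarrow> bool"
  where "intertwined b c \<longleftrightarrow> (\<forall>m\<in>mcarrier M. \<Phi> (m \<lhd>\<^bsub>M\<^esub> b) = \<Phi> m \<lhd>\<^bsub>N\<^esub> c)"

lemma intertwinedD: "intertwined b c \<Longrightarrow> m \<in> mcarrier M \<Longrightarrow> \<Phi> (m \<lhd>\<^bsub>M\<^esub> b) = \<Phi> m \<lhd>\<^bsub>N\<^esub> c"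
  by (simp add: intertwined_def)

lemma intertwined_rinner:
  "x \<in> mcarrier M \<Longrightarrow> y \<in> mcarrier M \<Longrightarrow> intertwined (rinner M x y) (rinner N (\<Phi> x) (\<Phi> y))"
  by (simp add: intertwined_def lact linner flip: bimodule_M.inner_compat bimodule_N.inner_compat)

lemma intertwined_add: "intertwined b c \<Longrightarrow> intertwined b' c' \<Longrightarrow> intertwined (b + b') (c + c')"
  by (simp add: intertwined_def bimodule_M.add_ract bimodule_N.add_ract add)

lemma intertwined_diff: "intertwined b c \<Longrightarrow> intertwined b' c' \<Longrightarrow> intertwined (b - b') (c - c')"
  by (simp add: intertwined_def bimodule_M.diff_ract bimodule_N.diff_ract iso_diff)

lemma intertwined_scaleC: "intertwined b c \<Longrightarrow> intertwined (r *\<^sub>C b) (r *\<^sub>C c)"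
  by (simp add: intertwined_def bimodule_M.scaleC_ract bimodule_N.scaleC_ract scaleC)

lemma intertwined_mult: "intertwined b c \<Longrightarrow> intertwined b' c' \<Longrightarrow> intertwined (b * b') (c * c')"
  by (simp add: intertwined_def bimodule_M.mult_ract bimodule_N.mult_ract)

text \<open>\<open>star b\<close> acts as the adjoint of the right action of \<open>b\<close> for
  the left inner product, and \<open>\<Phi>\<close> preserves that inner product.\<close>

lemma intertwined_star:
  assumes "intertwined b c"
  shows "intertwined (star b) (star c)"
  unfolding intertwined_def
proof
  fix m assume m [simp]: "m \<in> mcarrier M"
  show "\<Phi> (m \<lhd>\<^bsub>M\<^esub> star b) = \<Phi> m \<lhd>\<^bsub>N\<^esub> star c"
  proof (rule bimodule_N.linner_eqI)
    fix z assume z [simp]: "z \<in> mcarrier N"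
    have "linner N (\<Phi> (m \<lhd>\<^bsub>M\<^esub> star b)) z = linner M (m \<lhd>\<^bsub>M\<^esub> star b) (\<Psi> z)"
      using linner[of "m \<lhd>\<^bsub>M\<^esub> star b" "\<Psi> z"] by simp
    also have "\<dots> = linner M m (\<Psi> z \<lhd>\<^bsub>M\<^esub> b)"
      by (simp add: bimodule_M.linner_ract star_star)
    also have "\<dots> = linner N (\<Phi> m) (z \<lhd>\<^bsub>N\<^esub> c)"
      using linner[of m "\<Psi> z \<lhd>\<^bsub>M\<^esub> b"] intertwinedD[OF assms, of "\<Psi> z"] by simp
    also have "\<dots> = linner N (\<Phi> m \<lhd>\<^bsub>N\<^esub> star c) z"
      by (simp add: bimodule_N.linner_ract star_star)
    finally show "linner N (\<Phi> (m \<lhd>\<^bsub>M\<^esub> star b)) z = linner N (\<Phi> m \<lhd>\<^bsub>N\<^esub> star c) z" .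
  qed simp_all
qed

lemma intertwined_unique_left:
  assumes "intertwined b c" "intertwined b' c" "b \<in> \<langle>M\<rangle>\<^sub>R" "b' \<in> \<langle>M\<rangle>\<^sub>R"
  shows "b = b'"
proof (rule bimodule_M.right_ideal_faithful)
  fix m assume "m \<in> mcarrier M"
  with intertwinedD[OF assms(1) this] intertwinedD[OF assms(2) this] show "m \<lhd>\<^bsub>M\<^esub> b = m \<lhd>\<^bsub>M\<^esub> b'"
    by (intro iso_eqD) auto
qed fact+

text \<open>Symmetry: a result on \<open>intertwined b c\<close> yields, through
  \<open>intertwined_inverse\<close>, its mirror image with the roles of \<open>b\<close> and
  \<open>c\<close> exchanged.\<close>

lemma inverse: "left_iso_bimodules N M \<Psi>"
proof unfold_locales
  show "bij_betw \<Psi> (mcarrier N) (mcarrier M)"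
    by (rule bij_betw_inv_into[OF bij])
next
  fix x y assume "x \<in> mcarrier N" "y \<in> mcarrier N"
  then show "\<Psi> (x + y) = \<Psi> x + \<Psi> y"
    by (intro iso_eqD) (simp_all add: add)
next
  fix x c assume "x \<in> mcarrier N"
  then show "\<Psi> (c *\<^sub>C x) = c *\<^sub>C \<Psi> x"
    by (intro iso_eqD) (simp_all add: scaleC)
next
  fix x a assume "x \<in> mcarrier N"
  then show "\<Psi> (a \<rhd>\<^bsub>N\<^esub> x) = a \<rhd>\<^bsub>M\<^esub> \<Psi> x"
    by (intro iso_eqD) (simp_all add: lact)
next
  fix x y assume "x \<in> mcarrier N" "y \<in> mcarrier N"
  then show "linner M (\<Psi> x) (\<Psi> y) = linner N x y"
    using linner[of "\<Psi> x" "\<Psi> y"] by simp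
qed

lemma intertwined_inverse: "left_iso_bimodules.intertwined N M \<Psi> c b \<longleftrightarrow> intertwined b c"
proof -
  interpret inv: left_iso_bimodules N M \<Psi>
    by (rule inverse)
  show ?thesis
    unfolding inv.intertwined_def intertwined_def
  proof (intro iffI ballI)
    fix m assume *: "\<forall>n\<in>mcarrier N. \<Psi> (n \<lhd>\<^bsub>N\<^esub> c) = \<Psi> n \<lhd>\<^bsub>M\<^esub> b" and m: "m \<in> mcarrier M"
    then have "\<Psi> (\<Phi> m \<lhd>\<^bsub>N\<^esub> c) = m \<lhd>\<^bsub>M\<^esub> b" by simp
    from arg_cong[OF this, of \<Phi>] m show "\<Phi> (m \<lhd>\<^bsub>M\<^esub> b) = \<Phi> m \<lhd>\<^bsub>N\<^esub> c" by simp
  next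
    fix n assume *: "\<forall>m\<in>mcarrier M. \<Phi> (m \<lhd>\<^bsub>M\<^esub> b) = \<Phi> m \<lhd>\<^bsub>N\<^esub> c" and n: "n \<in> mcarrier N"
    then have "\<Phi> (\<Psi> n \<lhd>\<^bsub>M\<^esub> b) = n \<lhd>\<^bsub>N\<^esub> c" by simp
    from arg_cong[OF this, of \<Psi>] n show "\<Psi> (n \<lhd>\<^bsub>N\<^esub> c) = \<Psi> n \<lhd>\<^bsub>M\<^esub> b" by simp
  qed
qed

lemma intertwined_unique_right:
  assumes "intertwined b c" "intertwined b c'" "c \<in> \<langle>N\<rangle>\<^sub>R" "c' \<in> \<langle>N\<rangle>\<^sub>R"
  shows "c = c'"
  using left_iso_bimodules.intertwined_unique_left[OF inverse] assms by (auto simp: intertwined_inverse)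

lemma intertwined_norm_le_self_adjoint:
  assumes b: "b \<in> bimodule_M.rspan" "star b = b" and bc: "intertwined b c"
  shows "norm b \<le> norm c"
proof (rule ccontr)
  define \<mu> where "\<mu> = (norm b)\<^sup>2"
  assume "\<not> ?thesis"
  then have "norm c < norm b" by simp
  then have "norm (c * c) < \<mu>"
    unfolding \<mu>_def by (rule norm_square_less)
  then obtain u where u: "\<mu> *\<^sub>R u - u * (c * c) = c * c"
    using Neumann_resolvent by blast
  \<comment> \<open>The solution is \<open>\<mu> \<Phi> m (\<mu> - c\<^sup>2)^-1\<close> in
    \<open>N\<close>, pulled back to \<open>M\<close>, where the action of \<open>c\<^sup>2\<close>
    becomes that of \<open>b\<^sup>2\<close>.\<close>
  have solve: "\<exists>y\<in>mcarrier M. \<mu> *\<^sub>R m = \<mu> *\<^sub>R y - y \<lhd>\<^bsub>M\<^esub> (b * b)" if m [simp]: "m \<in> mcarrier M" for m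
  proof
    define y' where "y' = \<Phi> m + \<Phi> m \<lhd>\<^bsub>N\<^esub> u"
    have y' [simp]: "y' \<in> mcarrier N"
      by (simp add: y'_def)
    have "y' \<lhd>\<^bsub>N\<^esub> (c * c) = \<Phi> m \<lhd>\<^bsub>N\<^esub> (c * c + u * (c * c))"
      by (simp add: y'_def bimodule_N.ract_add bimodule_N.add_ract bimodule_N.mult_ract)
    also have "c * c + u * (c * c) = \<mu> *\<^sub>R u"
      using u by (simp add: diff_eq_eq)
    finally have y'_eq: "\<mu> *\<^sub>R \<Phi> m = \<mu> *\<^sub>R y' - y' \<lhd>\<^bsub>N\<^esub> (c * c)"
      by (simp add: y'_def bimodule_N.scaleR_ract scaleR_add_right)
    show "\<mu> *\<^sub>R m = \<mu> *\<^sub>R \<Psi> y' - \<Psi> y' \<lhd>\<^bsub>M\<^esub> (b * b)"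
      by (rule iso_eqD) (simp_all add: iso_diff iso_scaleR intertwinedD[OF intertwined_mult[OF bc bc]] y'_eq)
    show "\<Psi> y' \<in> mcarrier M" by simp
  qed
  \<comment> \<open>Pairing the solution for \<open>y\<close> with \<open>x\<close> divides
    \<open>rinner M x y\<close>. Linear combinations follow, and \<open>b\<close> is one of
    them.\<close>
  have "\<exists>g. \<mu> *\<^sub>R r = \<mu> *\<^sub>R g - g * (b * b)" if "r \<in> bimodule_M.rspan" for r
    using that
  proof (induction rule: bimodule_M.rspan_induct)
    case subspace
    show ?case
      unfolding complex_vector.subspace_def
    proof (intro conjI ballI allI; clarsimp)
      show "\<exists>g. \<mu> *\<^sub>R g = g * (b * b)"
        by (rule exI[of _ 0]) simp
    next
      fix x y g g'
      assume "\<mu> *\<^sub>R x = \<mu> *\<^sub>R g - g * (b * b)" "\<mu> *\<^sub>R y = \<mu> *\<^sub>R g' - g' * (b * b)"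
      then show "\<exists>g. \<mu> *\<^sub>R (x + y) = \<mu> *\<^sub>R g - g * (b * b)"
        by (intro exI[of _ "g + g'"]) (simp add: scaleR_add_right distrib_right add_diff_add)
    next
      fix d x g
      assume "\<mu> *\<^sub>R x = \<mu> *\<^sub>R g - g * (b * b)"
      from arg_cong[OF this, of "(*\<^sub>C) d"] show "\<exists>g. \<mu> *\<^sub>R (d *\<^sub>C x) = \<mu> *\<^sub>R g - g * (b * b)"
        by (intro exI[of _ "d *\<^sub>C g"])
          (simp add: scaleR_scaleC scaleC_scaleC mult.commute mult_scaleC_left
            complex_vector.scale_right_diff_distrib)
    qed
  next
    case (rinner x y)
    obtain z where z [simp]: "z \<in> mcarrier M" and "\<mu> *\<^sub>R y = \<mu> *\<^sub>R z - z \<lhd>\<^bsub>M\<^esub> (b * b)"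
      using solve rinner by blast
    from arg_cong[OF this(2), of "rinner M x"] rinner show ?case
      by (intro exI[of _ "rinner M x z"])
        (simp add: bimodule_M.rinner_diff bimodule_M.rinner_scaleR bimodule_M.rinner_ract)
  qed
  with b have "b = 0"
    unfolding \<mu>_def using self_adjoint_resolvent_eq_0 by blast
  with \<open>norm c < norm b\<close> show False by simp
qed

text \<open>The C*-identity reduces the claim to the self-adjoint pair \<open>star b * b\<close> and
  \<open>star c * c\<close>.\<close>

lemma intertwined_norm_le:
  assumes "b \<in> bimodule_M.rspan" and "intertwined b c"
  shows "norm b \<le> norm c"
proof -
  have "norm (star b * b) \<le> norm (star c * c)"
    using assms
    by (intro intertwined_norm_le_self_adjoint intertwined_mult intertwined_star bimodule_M.rspan_mult_left)
      (simp_all add: star_mult star_star)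
  then show ?thesis
    by (simp add: cstar_identity)
qed

lemma intertwined_norm_ge:
  assumes "c \<in> bimodule_N.rspan" and "intertwined b c"
  shows "norm c \<le> norm b"
  using left_iso_bimodules.intertwined_norm_le[OF inverse] assms by (auto simp: intertwined_inverse)

lemma intertwined_exists_rspan:
  assumes "c \<in> bimodule_N.rspan"
  shows "\<exists>b\<in>bimodule_M.rspan. intertwined b c"
  using assms
proof (induction rule: bimodule_N.rspan_induct)
  case subspace
  have "intertwined 0 0"
    using iso_diff[of 0 0] by (simp add: intertwined_def bimodule_M.ract_zero bimodule_N.ract_zero)
  then show ?case
    using bimodule_M.csubspace_rspan intertwined_add intertwined_scaleC
    unfolding complex_vector.subspace_def by blast
next
  case (rinner x y)
  then show ?case
    using intertwined_rinner[of "\<Psi> x" "\<Psi> y"] bimodule_M.rinner_in_rspan[of "\<Psi> x" "\<Psi> y"] by auto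
qed

text \<open>Approximate \<open>c\<close> by elements of the span. The norm inequality makes their
  intertwined partners a Cauchy sequence, whose limit is \<open>b\<close>.\<close>

lemma intertwined_exists:
  assumes "c \<in> \<langle>N\<rangle>\<^sub>R"
  obtains b where "b \<in> \<langle>M\<rangle>\<^sub>R" and "intertwined b c"
proof -
  obtain C where C: "\<And>n. C n \<in> bimodule_N.rspan" and C_lim: "C \<longlonglongrightarrow> c"
    using assms by (auto simp: bimodule_N.right_ideal_of_eq closure_sequential)
  obtain B where B: "\<And>n. B n \<in> bimodule_M.rspan" and BC: "\<And>n. intertwined (B n) (C n)"
    using intertwined_exists_rspan[OF C] by metis
  have "dist (B n) (B k) \<le> dist (C n) (C k)" for n k
    unfolding dist_norm
    by (intro intertwined_norm_le intertwined_diff BC csubspace_diff[OF bimodule_M.csubspace_rspan] B)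
  with LIMSEQ_imp_Cauchy[OF C_lim] have "Cauchy B"
    unfolding Cauchy_def by (meson le_less_trans)
  then obtain b where b: "B \<longlonglongrightarrow> b"
    by (auto simp: Cauchy_convergent_iff convergent_def)
  have "b \<in> \<langle>M\<rangle>\<^sub>R"
    using B b by (auto simp: bimodule_M.right_ideal_of_eq closure_sequential)
  moreover have "intertwined b c"
    unfolding intertwined_def
  proof
    fix m assume m [simp]: "m \<in> mcarrier M"
    show "\<Phi> (m \<lhd>\<^bsub>M\<^esub> b) = \<Phi> m \<lhd>\<^bsub>N\<^esub> c"
    proof (rule bimodule_N.rinner_eqI)
      fix z assume z [simp]: "z \<in> mcarrier N"
      define r where "r = rinner N z (\<Phi> m)"
      define s where "s = rinner M (\<Psi> z) m"
      define t where "t = rinner N z (\<Phi> (m \<lhd>\<^bsub>M\<^esub> b))"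
      \<comment> \<open>Continuity of \<open>\<Phi>\<close> along \<open>m B n\<close> is replaced
        by a norm bound: the difference is an inner product in \<open>N\<close> intertwined with
        \<open>rinner M (\<Psi> z) (m (B n - b))\<close>.\<close>
      have "norm (r * C n - t) \<le> norm (s * B n - s * b)" for n
      proof -
        have "r * C n - t = rinner N z (\<Phi> (m \<lhd>\<^bsub>M\<^esub> B n)) - t"
          by (simp add: r_def intertwinedD[OF BC] bimodule_N.rinner_ract)
        also have "\<dots> = rinner N (\<Phi> (\<Psi> z)) (\<Phi> (m \<lhd>\<^bsub>M\<^esub> (B n - b)))"
          by (simp add: t_def bimodule_M.diff_ract iso_diff bimodule_N.rinner_diff)
        also have "norm \<dots> \<le> norm (rinner M (\<Psi> z) (m \<lhd>\<^bsub>M\<^esub> (B n - b)))"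
          by (intro intertwined_norm_ge intertwined_rinner bimodule_N.rinner_in_rspan) simp_all
        also have "rinner M (\<Psi> z) (m \<lhd>\<^bsub>M\<^esub> (B n - b)) = s * B n - s * b"
          by (simp add: s_def bimodule_M.rinner_ract right_diff_distrib)
        finally show ?thesis .
      qed
      moreover have "(\<lambda>n. norm (s * B n - s * b)) \<longlonglongrightarrow> 0"
        using tendsto_norm[OF LIM_zero[OF tendsto_mult[OF tendsto_const b, of s]]] by simp
      ultimately have "(\<lambda>n. r * C n - t) \<longlonglongrightarrow> 0"
        by (rule Lim_null_comparison[OF always_eventually[OF allI]])
      then have "(\<lambda>n. r * C n) \<longlonglongrightarrow> t"
        by (rule LIM_zero_cancel)
      moreover have "(\<lambda>n. r * C n) \<longlonglongrightarrow> r * c"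
        by (intro tendsto_intros C_lim)
      ultimately have "t = r * c"
        by (rule LIMSEQ_unique)
      then show "rinner N z (\<Phi> (m \<lhd>\<^bsub>M\<^esub> b)) = rinner N z (\<Phi> m \<lhd>\<^bsub>N\<^esub> c)"
        by (simp add: t_def r_def bimodule_N.rinner_ract)
    qed simp_all
  qed
  ultimately show thesis by (rule that)
qed

section \<open>The partial automorphism\<close>

definition \<theta> :: "'a \<Rightarrow> 'a"
  where "\<theta> c = (THE b. b \<in> \<langle>M\<rangle>\<^sub>R \<and> intertwined b c)"

lemma theta_eqI: "b \<in> \<langle>M\<rangle>\<^sub>R \<Longrightarrow> intertwined b c \<Longrightarrow> \<theta> c = b"
  unfolding \<theta>_def by (rule the_equality) (auto intro: intertwined_unique_left)

lemma theta:
  assumes "c \<in> \<langle>N\<rangle>\<^sub>R"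
  shows "\<theta> c \<in> \<langle>M\<rangle>\<^sub>R" and "intertwined (\<theta> c) c"
  using intertwined_exists[OF assms] theta_eqI by metis+

text \<open>Injectivity is uniqueness of \<open>c\<close>; surjectivity is existence for the inverse
  isomorphism.\<close>

lemma bij_theta: "bij_betw \<theta> \<langle>N\<rangle>\<^sub>R \<langle>M\<rangle>\<^sub>R"
proof (rule bij_betw_imageI)
  show "inj_on \<theta> \<langle>N\<rangle>\<^sub>R"
    by (rule inj_onI) (metis intertwined_unique_right theta(2))
  show "\<theta> ` \<langle>N\<rangle>\<^sub>R = \<langle>M\<rangle>\<^sub>R"
  proof (intro equalityI subsetI)
    fix b assume b: "b \<in> \<langle>M\<rangle>\<^sub>R"
    then obtain c where "c \<in> \<langle>N\<rangle>\<^sub>R" "intertwined b c"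
      using left_iso_bimodules.intertwined_exists[OF inverse, of b] by (auto simp: intertwined_inverse)
    with b show "b \<in> \<theta> ` \<langle>N\<rangle>\<^sub>R"
      using theta_eqI by blast
  qed (auto simp: theta)
qed

lemma theta_rinner:
  "x \<in> mcarrier M \<Longrightarrow> y \<in> mcarrier M \<Longrightarrow> \<theta> (rinner N (\<Phi> x) (\<Phi> y)) = rinner M x y"
  by (intro theta_eqI intertwined_rinner bimodule_M.rinner_in_right_ideal)

lemma partial_automorphism_theta: "partial_automorphism \<langle>N\<rangle>\<^sub>R \<langle>M\<rangle>\<^sub>R \<theta>"
proof
  note closed = bimodule_M.right_ideal_closed bimodule_M.right_ideal_star
  show "closed_ideal \<langle>N\<rangle>\<^sub>R" "closed_ideal \<langle>M\<rangle>\<^sub>R" "bij_betw \<theta> \<langle>N\<rangle>\<^sub>R \<langle>M\<rangle>\<^sub>R"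
    by (rule bimodule_N.closed_ideal_right_ideal_of bimodule_M.closed_ideal_right_ideal_of bij_theta)+
  fix x y c assume x: "x \<in> \<langle>N\<rangle>\<^sub>R"
  show "\<theta> (c *\<^sub>C x) = c *\<^sub>C \<theta> x"
    using x by (intro theta_eqI intertwined_scaleC complex_vector.subspace_scale closed theta)
  show "\<theta> (star x) = star (\<theta> x)"
    using x by (intro theta_eqI intertwined_star closed theta)
  assume y: "y \<in> \<langle>N\<rangle>\<^sub>R"
  show "\<theta> (x + y) = \<theta> x + \<theta> y"
    using x y by (intro theta_eqI intertwined_add subspace_add closed theta)
  show "\<theta> (x * y) = \<theta> x * \<theta> y"
    using x y by (intro theta_eqI intertwined_mult closed(4) theta)
qed

section \<open>The twisted bimodule and its identification with \<open>N\<close>\<close>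

abbreviation twisted :: "('a, 'm) bimodule"
  where "twisted \<equiv> twist M \<langle>N\<rangle>\<^sub>R \<langle>M\<rangle>\<^sub>R \<theta>"

lemma inv_theta:
  assumes "b \<in> \<langle>M\<rangle>\<^sub>R"
  shows "inv_into \<langle>N\<rangle>\<^sub>R \<theta> b \<in> \<langle>N\<rangle>\<^sub>R" and "intertwined b (inv_into \<langle>N\<rangle>\<^sub>R \<theta> b)"
proof -
  show *: "inv_into \<langle>N\<rangle>\<^sub>R \<theta> b \<in> \<langle>N\<rangle>\<^sub>R"
    using bij_betwE[OF bij_betw_inv_into[OF bij_theta]] assms by blast
  show "intertwined b (inv_into \<langle>N\<rangle>\<^sub>R \<theta> b)"
    using theta(2)[OF *] bij_betw_inv_into_right[OF bij_theta assms] by simp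
qed

text \<open>\<open>M J = M\<close> because \<open>factorization\<close> writes each vector as a
  single product with a factor in \<open>J\<close>.\<close>

lemma twisted_carrier [simp]: "mcarrier twisted = mcarrier M"
proof
  show "mcarrier M \<subseteq> mcarrier twisted"
  proof
    fix x assume "x \<in> mcarrier M"
    then obtain m j where "m \<in> mcarrier M" "j \<in> \<langle>M\<rangle>\<^sub>R" "x = m \<lhd>\<^bsub>M\<^esub> j"
      using bimodule_M.factorization by blast
    then show "x \<in> mcarrier twisted"
      unfolding twist_def by auto
  qed
qed (auto simp: twist_def)

lemma twisted_left [simp]: "lact twisted = lact M" "linner twisted = linner M"
  by (simp_all add: twist_def)

lemma twisted_rinner [simp]:
  assumes "x \<in> mcarrier M" "y \<in> mcarrier M"
  shows "rinner twisted x y = rinner N (\<Phi> x) (\<Phi> y)"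
  using assms bij_betw_inv_into_left[OF bij_theta, of "rinner N (\<Phi> x) (\<Phi> y)"]
  by (simp add: twist_def theta_rinner bimodule_N.rinner_in_right_ideal)

text \<open>For \<open>x = m j\<close> the defining term is \<open>m \<theta> (c a)\<close> with
  \<open>c = \<theta>^-1 j\<close>. Its image is
  \<open>\<Phi> m c a = \<Phi> (m j) a = \<Phi> x a\<close>, which is independent of the
  factorization.\<close>

lemma twisted_ract [simp]:
  assumes x: "x \<in> mcarrier M"
  shows "x \<lhd>\<^bsub>twisted\<^esub> a = \<Psi> (\<Phi> x \<lhd>\<^bsub>N\<^esub> a)"
proof -
  have eq: "m \<lhd>\<^bsub>M\<^esub> \<theta> (inv_into \<langle>N\<rangle>\<^sub>R \<theta> j * a) = \<Psi> (\<Phi> (m \<lhd>\<^bsub>M\<^esub> j) \<lhd>\<^bsub>N\<^esub> a)"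
    if m: "m \<in> mcarrier M" and j: "j \<in> \<langle>M\<rangle>\<^sub>R" for m j
  proof (rule iso_eqD)
    have "inv_into \<langle>N\<rangle>\<^sub>R \<theta> j * a \<in> \<langle>N\<rangle>\<^sub>R"
      by (intro bimodule_N.right_ideal_closed(5) inv_theta j)
    from intertwinedD[OF theta(2)[OF this] m] intertwinedD[OF inv_theta(2)[OF j] m] m
    show "\<Phi> (m \<lhd>\<^bsub>M\<^esub> \<theta> (inv_into \<langle>N\<rangle>\<^sub>R \<theta> j * a)) = \<Phi> (\<Psi> (\<Phi> (m \<lhd>\<^bsub>M\<^esub> j) \<lhd>\<^bsub>N\<^esub> a))"
      by (simp add: bimodule_N.mult_ract)
  qed (use m in simp_all)
  obtain m j where "m \<in> mcarrier M" "j \<in> \<langle>M\<rangle>\<^sub>R" "x = m \<lhd>\<^bsub>M\<^esub> j"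
    using bimodule_M.factorization[OF x] by blast
  then show ?thesis
    unfolding twist_def by (simp, intro the_equality) (auto simp: eq)
qed

lemma hilbert_bimodule_iso_twisted: "hilbert_bimodule_iso twisted N \<Phi>"
proof -
  \<comment> \<open>The twisted inner product is that of the images in \<open>N\<close>. A Cauchy
    sequence is sent there, and its limit is brought back by \<open>\<Psi>\<close>.\<close>
  have complete: "ip_complete (rinner twisted) (mcarrier M)"
    unfolding ip_complete_def
  proof (intro allI impI)
    fix X :: "nat \<Rightarrow> 'm"
    assume X: "\<forall>n. X n \<in> mcarrier M"
      and Cauchy: "\<forall>e>0. \<exists>K. \<forall>i\<ge>K. \<forall>j\<ge>K. ip_norm (rinner twisted) (X i - X j) < e"
    have norm_eq: "ip_norm (rinner twisted) (x - y) = ip_norm (rinner N) (\<Phi> x - \<Phi> y)"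
      if "x \<in> mcarrier M" "y \<in> mcarrier M" for x y
      using that by (simp add: ip_norm_def iso_diff)
    have "\<forall>e>0. \<exists>K. \<forall>i\<ge>K. \<forall>j\<ge>K. ip_norm (rinner N) (\<Phi> (X i) - \<Phi> (X j)) < e"
      using Cauchy X by (simp add: norm_eq)
    moreover have "\<forall>n. \<Phi> (X n) \<in> mcarrier N"
      using X by simp
    ultimately obtain y where y: "y \<in> mcarrier N"
        and lim: "(\<lambda>n. ip_norm (rinner N) (\<Phi> (X n) - y)) \<longlonglongrightarrow> 0"
      using bimodule_N.rinner_complete[unfolded ip_complete_def, rule_format, of "\<lambda>n. \<Phi> (X n)"] by blast
    then show "\<exists>x\<in>mcarrier M. (\<lambda>n. ip_norm (rinner twisted) (X n - x)) \<longlonglongrightarrow> 0"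
      using X by (intro bexI[of _ "\<Psi> y"]) (simp_all add: norm_eq)
  qed
  have left: "left_hilbert_module twisted"
    by unfold_locales
      (auto intro: bimodule_M.lsubspace bimodule_M.linner_complete bimodule_M.linner_definite
        bimodule_M.linner_positive
        simp: bimodule_M.lact_add bimodule_M.add_lact bimodule_M.mult_lact bimodule_M.lact_scaleC
        bimodule_M.scaleC_lact bimodule_M.linner_add bimodule_M.linner_scaleC bimodule_M.linner_lact
        bimodule_M.star_linner)
  have right: "right_hilbert_module twisted"
  proof unfold_locales
    show "csubspace (mcarrier twisted)" "ip_complete (rinner twisted) (mcarrier twisted)"
      using bimodule_M.rsubspace complete by simp_all
    fix x y z a b c
    assume x: "x \<in> mcarrier twisted"
    show "x \<lhd>\<^bsub>twisted\<^esub> a \<in> mcarrier twisted"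
      using x by simp
    show "x \<lhd>\<^bsub>twisted\<^esub> (a + b) = x \<lhd>\<^bsub>twisted\<^esub> a + x \<lhd>\<^bsub>twisted\<^esub> b"
      using x by (intro iso_eqD) (simp_all add: bimodule_N.add_ract add)
    show "x \<lhd>\<^bsub>twisted\<^esub> (a * b) = x \<lhd>\<^bsub>twisted\<^esub> a \<lhd>\<^bsub>twisted\<^esub> b"
      using x by (simp add: bimodule_N.mult_ract)
    show "(c *\<^sub>C x) \<lhd>\<^bsub>twisted\<^esub> a = c *\<^sub>C (x \<lhd>\<^bsub>twisted\<^esub> a)"
      using x by (intro iso_eqD) (simp_all add: bimodule_N.ract_scaleC scaleC)
    show "x \<lhd>\<^bsub>twisted\<^esub> (c *\<^sub>C a) = c *\<^sub>C (x \<lhd>\<^bsub>twisted\<^esub> a)"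
      using x by (intro iso_eqD) (simp_all add: bimodule_N.scaleC_ract scaleC)
    show "positive (rinner twisted x x)"
      using x by (simp add: bimodule_N.rinner_positive)
    show "x = 0" if "rinner twisted x x = 0"
    proof (rule iso_eqD)
      show "\<Phi> x = \<Phi> 0"
        using that x iso_diff[of x x] bimodule_N.rinner_definite[of "\<Phi> x"] by simp
    qed (use x in simp_all)
    assume y: "y \<in> mcarrier twisted"
    show "(x + y) \<lhd>\<^bsub>twisted\<^esub> a = x \<lhd>\<^bsub>twisted\<^esub> a + y \<lhd>\<^bsub>twisted\<^esub> a"
      using x y by (intro iso_eqD) (simp_all add: bimodule_N.ract_add add)
    show "rinner twisted x (c *\<^sub>C y) = c *\<^sub>C rinner twisted x y"
      using x y by (simp add: bimodule_N.rinner_scaleC scaleC)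
    show "rinner twisted x (y \<lhd>\<^bsub>twisted\<^esub> a) = rinner twisted x y * a"
      using x y by (simp add: bimodule_N.rinner_ract)
    show "star (rinner twisted x y) = rinner twisted y x"
      using x y by (simp add: bimodule_N.star_rinner)
    assume z: "z \<in> mcarrier twisted"
    show "rinner twisted x (y + z) = rinner twisted x y + rinner twisted x z"
      using x y z by (simp add: bimodule_N.rinner_add add)
  qed
  have bimodule: "hilbert_bimodule twisted"
  proof (intro hilbert_bimodule.intro hilbert_bimodule_axioms.intro left right)
    fix x y z a b
    assume x: "x \<in> mcarrier twisted"
    show "(a \<rhd>\<^bsub>twisted\<^esub> x) \<lhd>\<^bsub>twisted\<^esub> b = a \<rhd>\<^bsub>twisted\<^esub> (x \<lhd>\<^bsub>twisted\<^esub> b)"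
      using x by (intro iso_eqD) (simp_all add: lact bimodule_N.act_assoc)
    assume y: "y \<in> mcarrier twisted" and z: "z \<in> mcarrier twisted"
    \<comment> \<open>Rewriting the left inner product as that of the images reduces the law to
      \<open>inner_compat\<close> in \<open>N\<close>.\<close>
    show "linner twisted x y \<rhd>\<^bsub>twisted\<^esub> z = x \<lhd>\<^bsub>twisted\<^esub> rinner twisted y z"
      using x y z by (intro iso_eqD) (simp_all add: lact bimodule_N.inner_compat flip: linner)
  qed
  have iso: "carrier_iso twisted N \<Phi>"
    by unfold_locales (simp_all add: bij add scaleC)
  have "left_hilbert_iso twisted N \<Phi>"
    by (intro left_hilbert_iso.intro left_hilbert_iso_axioms.intro iso left)
      (simp_all add: lact linner bimodule_N.left_hilbert_module_axioms)
  moreover have "right_hilbert_iso twisted N \<Phi>"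
    by (intro right_hilbert_iso.intro right_hilbert_iso_axioms.intro iso right)
      (simp_all add: bimodule_N.right_hilbert_module_axioms)
  ultimately show ?thesis
    by (intro hilbert_bimodule_iso.intro bimodule bimodule_N.hilbert_bimodule_axioms)
qed

end

theorem proposition1p1:
  fixes M :: "('a::cstar_algebra, 'm::complex_vector) bimodule"
    and N :: "('a, 'n::complex_vector) bimodule"
    and \<Phi> :: "'m \<Rightarrow> 'n"
  assumes "hilbert_bimodule M"
    and "hilbert_bimodule N"
    and "left_hilbert_iso M N \<Phi>"
  shows "\<exists>I J \<theta>. partial_automorphism I J \<theta> \<and>
    hilbert_bimodule_iso (twist M I J \<theta>) N \<Phi> \<and>
    I = \<langle>N\<rangle>\<^sub>R \<and> J = \<langle>M\<rangle>\<^sub>R \<and>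
    (\<forall>m\<^sub>0\<in>mcarrier M. \<forall>m\<^sub>1\<in>mcarrier M.
      \<theta> (rinner N (\<Phi> m\<^sub>0) (\<Phi> m\<^sub>1)) = rinner M m\<^sub>0 m\<^sub>1)"
proof -
  interpret left_iso_bimodules M N \<Phi>
    using assms by (rule left_iso_bimodules.intro)
  show ?thesis
    using partial_automorphism_theta hilbert_bimodule_iso_twisted theta_rinner by blast
qed

end
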